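(* Let $\mu$ be a diagram and let $d$ be the number of boxes on the main diagonal of $\mu$. The dual Schur function $\widehat s_\mu(x\|a)$ has the expansion $$\widehat s_\mu(x\|a)=\sum_\lambda(-1)^{n(\lambda/\mu)}\,\varphi_{\lambda/\mu}(a)\,s_\lambda(x),$$ summed over diagrams $\lambda$ which contain $\mu$ and such that $\lambda$ has $d$ boxes on the main diagonal, where $n(\lambda/\mu)$ denotes the total number of boxes of $\lambda/\mu$ in rows $d+1,d+2,\dots$, and $s_\lambda(x)$ are the ordinary Schur functions.
   Context: Let $a=(a_i)_{i\in\mathbb Z}$ be a sequence of commuting indeterminates and $\mathbb Q[a]$ the polynomial ring in the $a_i$; $x=(x_1,x_2,\dots)$. Dual Schur functions: let $\widehat\Lambda(x\|a)$ be the ring of formal (possibly infinite) sums $\sum_{\lambda}c_\lambda(a)s_\lambda(x)$, $c_\lambda(a)\in\mathbb Q[a]$. For a partition $\mu$ with $d$ boxes on the main diagonal and $n\geqslant\ell(\mu)$, $$\widehat s_\mu(x_1,\dots,x_n\|a)=\frac{\det[A_{ij}]_{i,j=1}^n}{\prod_{1\leqslant i<j\leqslant n}(x_i-x_j)},$$ where $A_{ij}=\dfrac{x_i^{\mu_j+n-j}}{(1-a_0x_i)(1-a_{-1}x_i)\cdots(1-a_{j-\mu_j}x_i)}$ for $1\leqslant j\leqslant d$ and $A_{ij}=x_i^{\mu_j+n-j}(1-a_1x_i)\cdots(1-a_{j-\mu_j-1}x_i)$ for $d<j\leqslant n$; it is $0$ if $\ell(\mu)>n$. These are compatible with setting $x_n=0$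 and define $\widehat s_\mu(x\|a)\in\widehat\Lambda(x\|a)$. Suppose $\mu\subseteq\lambda$ both have $d$ boxes on the main diagonal. A hook $\lambda/\mu$-tableau is a filling $T$ of the boxes of $\lambda/\mu$ with integers such that: the entries in the first $d$ rows weakly increase along the rows and strictly increase down the columns, and all entries in row $i$ belong to $\{i-\mu_i,\dots,-1,0\}$ for $i=1,\dots,d$; the entries in the first $d$ columns weakly decrease down the columns and strictly decrease along the rows, and all entries in column $j$ belong to $\{1,2,\dots,\mu'_j-j+1\}$ for $j=1,\dots,d$ ($\mu'$ is the conjugate of $\mu$). Then $\varphi_{\lambda/\mu}(a)=\sum_T\prod_{\alpha\in\lambda/\mu}a_{T(\alpha)}$, summed over the hook $\lambda/\mu$-tableaux $T$. *)

theory Defs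
  imports "HOL-Library.Poly_Mapping" "HOL-Library.FuncSet" "Jordan_Normal_Form.Determinant"
begin

section \<open>Formal power series in countably many variables\<close>

text \<open>A power series is its family of coefficients, indexed by the exponent vectors
  of finite support.\<close>

typedef 'a mps = "UNIV :: ((nat \<Rightarrow>\<^sub>0 nat) \<Rightarrow> 'a) set"
  morphisms mps_coeff Abs_mps by simp

setup_lifting type_definition_mps

lemma mps_eqI: "(\<And>m. mps_coeff f m = mps_coeff g m) \<Longrightarrow> f = g"
  by (simp add: mps_coeff_inject[symmetric] fun_eq_iff)

lemma finite_below_exponent: "finite {p :: nat \<Rightarrow>\<^sub>0 nat. \<forall>i. Poly_Mapping.lookup p i \<le> Poly_Mapping.lookup m i}"
proof (rule finite_imageD)
  let ?S = "{p :: nat \<Rightarrow>\<^sub>0 nat. \<forall>i. Poly_Mapping.lookup p i \<le> Poly_Mapping.lookup m i}"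
  show "inj_on (\<lambda>p. restrict (Poly_Mapping.lookup p) (Poly_Mapping.keys m)) ?S"
  proof (rule inj_onI)
    fix p q
    assume pq: "p \<in> ?S" "q \<in> ?S"
      and eq: "restrict (Poly_Mapping.lookup p) (Poly_Mapping.keys m) = restrict (Poly_Mapping.lookup q) (Poly_Mapping.keys m)"
    show "p = q"
    proof (rule poly_mapping_eqI)
      fix i
      show "Poly_Mapping.lookup p i = Poly_Mapping.lookup q i"
      proof (cases "i \<in> Poly_Mapping.keys m")
        case True
        then show ?thesis using fun_cong[OF eq, of i] by simp
      next
        case False
        then have "Poly_Mapping.lookup m i = 0" by (simp add: in_keys_iff)
        then show ?thesis using pq by (metis (mono_tags) le_zero_eq mem_Collect_eq)
      qed
    qed
  qed
  have "(\<lambda>p. restrict (Poly_Mapping.lookup p) (Poly_Mapping.keys m)) ` ?S \<subseteq> (\<Pi>\<^sub>E i\<in>Poly_Mapping.keys m. {..Poly_Mapping.lookup m i})"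
    by auto
  then show "finite ((\<lambda>p. restrict (Poly_Mapping.lookup p) (Poly_Mapping.keys m)) ` ?S)"
    by (rule finite_subset) (auto intro: finite_PiE)
qed

lemma finite_splittings: "finite {(p, q). p + q = (m :: nat \<Rightarrow>\<^sub>0 nat)}"
proof -
  let ?B = "{p :: nat \<Rightarrow>\<^sub>0 nat. \<forall>i. Poly_Mapping.lookup p i \<le> Poly_Mapping.lookup m i}"
  have "{(p, q). p + q = m} \<subseteq> ?B \<times> ?B" by (auto simp: lookup_add)
  then show ?thesis
    by (rule finite_subset) (intro finite_cartesian_product finite_below_exponent)
qed

instantiation mps :: (comm_ring_1) comm_ring_1
begin

lift_definition zero_mps :: "'a mps" is "\<lambda>_. 0" .
lift_definition one_mps :: "'a mps" is "\<lambda>m. if m = 0 then 1 else 0" .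
lift_definition plus_mps :: "'a mps \<Rightarrow> 'a mps \<Rightarrow> 'a mps" is "\<lambda>f g m. f m + g m" .
lift_definition minus_mps :: "'a mps \<Rightarrow> 'a mps \<Rightarrow> 'a mps" is "\<lambda>f g m. f m - g m" .
lift_definition uminus_mps :: "'a mps \<Rightarrow> 'a mps" is "\<lambda>f m. - f m" .
lift_definition times_mps :: "'a mps \<Rightarrow> 'a mps \<Rightarrow> 'a mps"
  is "\<lambda>f g m. \<Sum>(p, q)\<in>{(p, q). p + q = m}. f p * g q" .

instance
proof
  fix f g h :: "'a mps"
  show "f * g * h = f * (g * h)"
  proof (transfer, rule ext)
    fix f g h :: "(nat \<Rightarrow>\<^sub>0 nat) \<Rightarrow> 'a" and m
    let ?S = "\<lambda>m :: nat \<Rightarrow>\<^sub>0 nat. {(p, q). p + q = m}"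
    have "(\<Sum>(u, r)\<in>?S m. (\<Sum>(p, q)\<in>?S u. f p * g q) * h r)
        = (\<Sum>(u, pq)\<in>(SIGMA u:?S m. ?S (fst u)). f (fst pq) * g (snd pq) * h (snd u))"
      by (subst sum.Sigma[symmetric])
         (auto simp: finite_splittings finite_splittings[unfolded split_def] sum_distrib_right split_def intro!: sum.cong)
    also have "\<dots> = (\<Sum>(u, qr)\<in>(SIGMA u:?S m. ?S (snd u)). f (fst u) * (g (fst qr) * h (snd qr)))"
      by (rule sum.reindex_bij_witness[where
            i = "\<lambda>((p, v), (q, r)). ((p + q, r), (p, q))" and
            j = "\<lambda>((u, r), (p, q)). ((p, q + r), (q, r))"])
         (auto simp: algebra_simps)
    also have "\<dots> = (\<Sum>(p, v)\<in>?S m. f p * (\<Sum>(q, r)\<in>?S v. g q * h r))"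
      by (subst sum.Sigma[symmetric])
         (auto simp: finite_splittings finite_splittings[unfolded split_def] sum_distrib_left split_def intro!: sum.cong)
    finally show "(\<Sum>(u, r)\<in>?S m. (\<Sum>(p, q)\<in>?S u. f p * g q) * h r)
        = (\<Sum>(p, v)\<in>?S m. f p * (\<Sum>(q, r)\<in>?S v. g q * h r))" .
  qed
  show "f * g = g * f"
  proof (transfer, rule ext)
    fix f g :: "(nat \<Rightarrow>\<^sub>0 nat) \<Rightarrow> 'a" and m
    show "(\<Sum>(p, q)\<in>{(p, q). p + q = m}. f p * g q) = (\<Sum>(p, q)\<in>{(p, q). p + q = m}. g p * f q)"
      by (rule sum.reindex_bij_witness[where i = prod.swap and j = prod.swap])
         (auto simp: algebra_simps)
  qed
  show "1 * f = f"
  proof (transfer, rule ext)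
    fix f :: "(nat \<Rightarrow>\<^sub>0 nat) \<Rightarrow> 'a" and m
    have "(\<Sum>(p, q)\<in>{(p, q). p + q = m}. (if p = 0 then 1 else 0) * f q)
        = (\<Sum>(p, q)\<in>{(0 :: nat \<Rightarrow>\<^sub>0 nat, m)}. (if p = 0 then 1 else 0) * f q)"
      by (intro sum.mono_neutral_right) (auto simp: finite_splittings split: if_splits)
    then show "(\<Sum>(p, q)\<in>{(p, q). p + q = m}. (if p = 0 then 1 else 0) * f q) = f m"
      by simp
  qed
  show "(f + g) * h = f * h + g * h"
    by transfer (auto simp: fun_eq_iff split_def algebra_simps sum.distrib)
  show "(0 :: 'a mps) \<noteq> 1"
    by transfer (auto simp: fun_eq_iff)
qed (transfer; simp add: algebra_simps fun_eq_iff)+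

end

definition mps_const :: "'a::comm_ring_1 \<Rightarrow> 'a mps" where
  "mps_const c = Abs_mps (\<lambda>m. if m = 0 then c else 0)"

text \<open>The variables are \<open>x\<^sub>1, x\<^sub>2, \<dots>\<close>; the variable \<open>x\<^sub>i\<close> is stored at index \<open>i - 1\<close> of an
  exponent vector, so that there is no unused variable \<open>x\<^sub>0\<close>.  Only \<open>xvar i\<close> with \<open>i \<ge> 1\<close> is
  meaningful.\<close>

definition xvar :: "nat \<Rightarrow> 'a::comm_ring_1 mps" where
  "xvar i = Abs_mps (\<lambda>m. if m = Poly_Mapping.single (i - 1) 1 then 1 else 0)"

text \<open>Specialisation \<open>x\<^sub>i = 0\<close> for all \<open>i > n\<close>.\<close>

definition mps_restrict :: "nat \<Rightarrow> 'a::comm_ring_1 mps \<Rightarrow> 'a mps" where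
  "mps_restrict n f = Abs_mps (\<lambda>m. if Poly_Mapping.keys m \<subseteq> {..<n} then mps_coeff f m else 0)"

text \<open>The fraction \<open>f / g\<close>, for \<open>g\<close> not a zero divisor and dividing \<open>f\<close>.\<close>

definition mps_quot :: "'a::comm_ring_1 mps \<Rightarrow> 'a mps \<Rightarrow> 'a mps" where
  "mps_quot f g = (THE h. h * g = f)"

text \<open>\<open>g\<close> is the formal, possibly infinite, sum of the \<open>F k\<close> with \<open>k \<in> K\<close>: every monomial occurs
  in only finitely many summands, and its coefficients add up to its coefficient in \<open>g\<close>.\<close>

definition has_formal_sum :: "('k \<Rightarrow> 'a::comm_ring_1 mps) \<Rightarrow> 'k set \<Rightarrow> 'a mps \<Rightarrow> bool" where
  "has_formal_sum F K g \<longleftrightarrow>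
    (\<forall>m. finite {k \<in> K. mps_coeff (F k) m \<noteq> 0} \<and>
         mps_coeff g m = (\<Sum>k\<in>{k \<in> K. mps_coeff (F k) m \<noteq> 0}. mps_coeff (F k) m))"


section \<open>The polynomial ring \<open>\<rat>[a]\<close>\<close>

type_synonym Qa = "(int \<Rightarrow>\<^sub>0 nat) \<Rightarrow>\<^sub>0 rat"

definition avar :: "int \<Rightarrow> Qa" where
  "avar i = Poly_Mapping.single (Poly_Mapping.single i 1) 1"


section \<open>Partitions and diagrams\<close>

text \<open>A partition is the list of its positive parts; rows and columns are numbered from 1.\<close>

definition is_partition :: "nat list \<Rightarrow> bool" where
  "is_partition \<mu> \<longleftrightarrow> sorted_wrt (\<ge>) \<mu> \<and> 0 \<notin> set \<mu>"

definition part :: "nat list \<Rightarrow> nat \<Rightarrow> nat" where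
  "part \<mu> i = (if 1 \<le> i \<and> i \<le> length \<mu> then \<mu> ! (i - 1) else 0)"

definition diagram :: "nat list \<Rightarrow> (nat \<times> nat) set" where
  "diagram \<mu> = {(i, j). 1 \<le> i \<and> 1 \<le> j \<and> j \<le> part \<mu> i}"

definition conj_part :: "nat list \<Rightarrow> nat \<Rightarrow> nat" where
  "conj_part \<mu> j = card {i. (i, j) \<in> diagram \<mu>}"

definition diag_len :: "nat list \<Rightarrow> nat" where
  "diag_len \<mu> = card {i. (i, i) \<in> diagram \<mu>}"

definition skew :: "nat list \<Rightarrow> nat list \<Rightarrow> (nat \<times> nat) set" where
  "skew \<nu> \<mu> = diagram \<nu> - diagram \<mu>"


section \<open>Schur functions and dual Schur functions\<close>

definition vandermonde :: "nat \<Rightarrow> Qa mps" where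
  "vandermonde n = (\<Prod>j\<in>{1..n}. \<Prod>i\<in>{1..<j}. xvar i - xvar j)"

text \<open>Matrix entries are addressed from 0 in the library, whence the shifts by one below.\<close>

definition schur_poly :: "nat \<Rightarrow> nat list \<Rightarrow> Qa mps" where
  "schur_poly n \<mu> =
    (if length \<mu> > n then 0
     else mps_quot
       (det (mat n n (\<lambda>(i, j). xvar (i + 1) ^ (part \<mu> (j + 1) + n - (j + 1)))))
       (vandermonde n))"

text \<open>The inverse limit: the series restricting to the \<open>n\<close>-variable version for every \<open>n\<close>.\<close>

definition schur :: "nat list \<Rightarrow> Qa mps" where
  "schur \<mu> = (THE f. \<forall>n. mps_restrict n f = schur_poly n \<mu>)"

definition dual_schur_entry :: "nat \<Rightarrow> nat list \<Rightarrow> nat \<Rightarrow> nat \<Rightarrow> Qa mps" where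
  "dual_schur_entry n \<mu> i j =
    (if j \<le> diag_len \<mu>
     then mps_quot
       (xvar i ^ (part \<mu> j + n - j))
       (\<Prod>k\<in>{int j - int (part \<mu> j)..0}. 1 - mps_const (avar k) * xvar i)
     else xvar i ^ (part \<mu> j + n - j) *
       (\<Prod>k\<in>{1..int j - int (part \<mu> j) - 1}. 1 - mps_const (avar k) * xvar i))"

definition dual_schur_fin :: "nat \<Rightarrow> nat list \<Rightarrow> Qa mps" where
  "dual_schur_fin n \<mu> =
    (if length \<mu> > n then 0
     else mps_quot
       (det (mat n n (\<lambda>(i, j). dual_schur_entry n \<mu> (i + 1) (j + 1))))
       (vandermonde n))"

text \<open>Formal sums of Schur functions are identified with the power series they sum to, which is
  faithful because the Schur functions are homogeneous and linearly independent.\<close>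

definition Lambda_hat :: "Qa mps set" where
  "Lambda_hat =
    {f. \<exists>c :: nat list \<Rightarrow> Qa.
       has_formal_sum (\<lambda>\<mu>. mps_const (c \<mu>) * schur \<mu>) {\<mu>. is_partition \<mu>} f}"

definition dual_schur :: "nat list \<Rightarrow> Qa mps" where
  "dual_schur \<mu> =
    (THE f. f \<in> Lambda_hat \<and> (\<forall>n. mps_restrict n f = dual_schur_fin n \<mu>))"


section \<open>Hook tableaux\<close>

text \<open>For \<open>\<mu> \<subseteq> \<nu>\<close> with the same number \<open>d\<close> of diagonal boxes, each box of \<open>\<nu>/\<mu>\<close> lies either in the
  first \<open>d\<close> rows or in the first \<open>d\<close> columns, but not in both.  Fillings are extensional, i.e. fixed
  outside \<open>\<nu>/\<mu>\<close>, so that each filling is counted once.\<close>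

definition hook_tableaux :: "nat list \<Rightarrow> nat list \<Rightarrow> (nat \<times> nat \<Rightarrow> int) set" where
  "hook_tableaux \<nu> \<mu> =
    (let d = diag_len \<mu>; S = skew \<nu> \<mu> in
     {T \<in> extensional S.
       (\<forall>i j. (i, j) \<in> S \<and> i \<le> d \<longrightarrow> T (i, j) \<in> {int i - int (part \<mu> i)..0}) \<and>
       (\<forall>i j l. (i, j) \<in> S \<and> (i, l) \<in> S \<and> i \<le> d \<and> j < l \<longrightarrow> T (i, j) \<le> T (i, l)) \<and>
       (\<forall>i k j. (i, j) \<in> S \<and> (k, j) \<in> S \<and> i < k \<and> k \<le> d \<longrightarrow> T (i, j) < T (k, j)) \<and>
       (\<forall>i j. (i, j) \<in> S \<and> j \<le> d \<longrightarrow> T (i, j) \<in> {1..int (conj_part \<mu> j) - int j + 1}) \<and>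
       (\<forall>i k j. (i, j) \<in> S \<and> (k, j) \<in> S \<and> j \<le> d \<and> i < k \<longrightarrow> T (i, j) \<ge> T (k, j)) \<and>
       (\<forall>i j l. (i, j) \<in> S \<and> (i, l) \<in> S \<and> j < l \<and> l \<le> d \<longrightarrow> T (i, j) > T (i, l))})"

definition hook_phi :: "nat list \<Rightarrow> nat list \<Rightarrow> Qa" where
  "hook_phi \<nu> \<mu> = (\<Sum>T\<in>hook_tableaux \<nu> \<mu>. \<Prod>\<alpha>\<in>skew \<nu> \<mu>. avar (T \<alpha>))"

definition low_boxes :: "nat list \<Rightarrow> nat list \<Rightarrow> nat" where
  "low_boxes \<nu> \<mu> = card {(i, j). (i, j) \<in> skew \<nu> \<mu> \<and> i > diag_len \<mu>}"

end

theory Submission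
  imports Defs "HOL-Computational_Algebra.Polynomial"
begin

text \<open>The determinant that defines the dual Schur function in \<open>n\<close> variables is expanded one letter
  \<open>a\<^sub>k\<close> at a time, modulo power series of high order.  A factor \<open>1 / (1 - a\<^sub>k x\<^sub>i)\<close> shared by the
  first \<open>r\<close> columns adds a horizontal strip to the first \<open>r\<close> rows, and a factor \<open>1 - a\<^sub>k x\<^sub>i\<close> shared by
  later columns adds a vertical strip, with a sign for each box, to the corresponding rows.  Adding
  the strips for \<open>\<dots>, a\<^sub>-\<^sub>1, a\<^sub>0\<close> and then for \<open>a\<^sub>n, \<dots>, a\<^sub>1\<close> builds exactly the hook tableaux and leaves
  the alternants of the ordinary Schur polynomials.\<close>

section \<open>Power series: order, restriction and cancellation\<close>

text \<open>The quotient by the Vandermonde product is unique, so for each \<open>n\<close> it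
  suffices to compare numerators. The obstacle is that the column arguments need neighbouring
  columns which still carry the same factors. Since j - mu_j increases strictly with j, the letter
  a_k with k <= 0 occurs in an initial segment of the columns, and a_k with k >= 1 in a final
  segment. If the letters up to a_0 are expanded upwards and the others downwards from a_n, every
  column containing the current letter also contains all later letters of its kind, so such columns
  differ only in their powers of x_i. This dictates the order of the letters and the reversal of the
  indices 1..n. The geometric series in the first column has no predecessor to stop it; hence the
  bound \<open>B\<close> on the first row and the computation modulo order \<open>B\<close>, which
  makes every sum finite. As \<open>B\<close> is arbitrary, the truncated identities give an exact
  one.\<close>

lemma mps_coeff_zero [simp]: "mps_coeff 0 m = 0"
  by transfer simp

lemma mps_coeff_one: "mps_coeff 1 m = (if m = 0 then 1 else 0)"
  by transfer simp

lemma mps_coeff_add [simp]: "mps_coeff (f + g) m = mps_coeff f m + mps_coeff g m"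
  by transfer simp

lemma mps_coeff_diff [simp]: "mps_coeff (f - g) m = mps_coeff f m - mps_coeff g m"
  by transfer simp

lemma mps_coeff_uminus [simp]: "mps_coeff (- f) m = - mps_coeff f m"
  by transfer simp

lemma mps_coeff_mult:
  "mps_coeff (f * g) m = (\<Sum>(p, q)\<in>{(p, q). p + q = m}. mps_coeff f p * mps_coeff g q)"
  by (simp add: times_mps.rep_eq)

lemma mps_coeff_sum: "mps_coeff (\<Sum>k\<in>K. F k) m = (\<Sum>k\<in>K. mps_coeff (F k) m)"
  by (induction K rule: infinite_finite_induct) auto

lemma mps_coeff_Abs [simp]: "mps_coeff (Abs_mps f) m = f m"
  by (simp add: Abs_mps_inverse)

lemma mps_coeff_const: "mps_coeff (mps_const c) m = (if m = 0 then c else 0)"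
  by (simp add: mps_const_def)

lemma mps_coeff_const_mult [simp]: "mps_coeff (mps_const c * f) m = c * mps_coeff f m"
proof -
  have "mps_coeff (mps_const c * f) m
      = (\<Sum>(p, q)\<in>{(0 :: nat \<Rightarrow>\<^sub>0 nat, m)}. mps_coeff (mps_const c) p * mps_coeff f q)"
    unfolding mps_coeff_mult
    by (intro sum.mono_neutral_right) (auto simp: finite_splittings mps_coeff_const split: if_splits)
  then show ?thesis by (simp add: mps_coeff_const)
qed

lemma mps_const_0 [simp]: "mps_const 0 = 0"
  by (rule mps_eqI) (simp add: mps_coeff_const)

lemma mps_const_1 [simp]: "mps_const 1 = 1"
  by (rule mps_eqI) (simp add: mps_coeff_const mps_coeff_one)

lemma mps_const_add: "mps_const (a + b) = mps_const a + mps_const b"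
  by (rule mps_eqI) (simp add: mps_coeff_const)

lemma mps_const_uminus: "mps_const (- a) = - mps_const a"
  by (rule mps_eqI) (simp add: mps_coeff_const)

lemma mps_const_mult: "mps_const (a * b) = mps_const a * mps_const b"
  by (rule mps_eqI) (simp add: mps_coeff_const)

lemma mps_const_sum: "mps_const (\<Sum>k\<in>K. F k) = (\<Sum>k\<in>K. mps_const (F k))"
  by (induction K rule: infinite_finite_induct) (auto simp: mps_const_add)

lemma mps_const_power: "mps_const (a ^ n) = mps_const a ^ n"
  by (induction n) (auto simp: mps_const_mult)

lemma mps_coeff_xvar_mult:
  "mps_coeff (xvar i * f) (m + Poly_Mapping.single (i - 1) 1) = mps_coeff f m"
proof -
  let ?e = "Poly_Mapping.single (i - 1) (1 :: nat)"
  have "mps_coeff (xvar i * f) (m + ?e)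
      = (\<Sum>(p, q)\<in>{(?e, m)}. mps_coeff (xvar i) p * mps_coeff f q)"
    unfolding mps_coeff_mult
    by (intro sum.mono_neutral_right)
       (auto simp: finite_splittings xvar_def add.commute split: if_splits)
  then show ?thesis by (simp add: xvar_def)
qed

lemma mps_coeff_xvar_mult_0:
  assumes "Poly_Mapping.lookup m (i - 1) = 0"
  shows "mps_coeff (xvar i * f) m = 0"
  unfolding mps_coeff_mult
  using assms by (intro sum.neutral) (auto simp: xvar_def lookup_add)

lemma xvar_mult_cancel: "xvar i * f = xvar i * g \<Longrightarrow> f = g"
  by (rule mps_eqI) (metis mps_coeff_xvar_mult)

lemma poly_mapping_split_single:
  assumes "Poly_Mapping.lookup m i > (0 :: nat)"
  obtains m' where "m = m' + Poly_Mapping.single i 1"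
proof
  show "m = (m - Poly_Mapping.single i 1) + Poly_Mapping.single i 1"
    using assms by (intro poly_mapping_eqI) (auto simp: lookup_add lookup_minus lookup_single when_def)
qed

section \<open>Order of a power series by total degree\<close>

definition total_deg :: "(nat \<Rightarrow>\<^sub>0 nat) \<Rightarrow> nat" where
  "total_deg m = (\<Sum>i\<in>Poly_Mapping.keys m. Poly_Mapping.lookup m i)"

lemma total_deg_add: "total_deg (p + q) = total_deg p + total_deg q"
  unfolding total_deg_def by (rule setsum_keys_plus_distrib) auto

lemma total_deg_single [simp]: "total_deg (Poly_Mapping.single i k) = k"
  by (simp add: total_deg_def)

text \<open>Congruence modulo order \<open>k\<close> is expressed as
  \<open>order_ge k (f - g)\<close>. It takes the place of convergence; \<open>mps_eq_0I\<close>
  turns congruence modulo every order into equality.\<close>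

definition order_ge :: "nat \<Rightarrow> 'a::comm_ring_1 mps \<Rightarrow> bool" where
  "order_ge k f \<longleftrightarrow> (\<forall>m. total_deg m < k \<longrightarrow> mps_coeff f m = 0)"

lemma order_ge_0 [simp]: "order_ge k 0" "order_ge 0 f"
  by (auto simp: order_ge_def)

lemma order_ge_add: "order_ge k f \<Longrightarrow> order_ge k g \<Longrightarrow> order_ge k (f + g)"
  by (auto simp: order_ge_def)

lemma order_ge_diff: "order_ge k f \<Longrightarrow> order_ge k g \<Longrightarrow> order_ge k (f - g)"
  by (auto simp: order_ge_def)

lemma order_ge_sum: "(\<And>x. x \<in> K \<Longrightarrow> order_ge k (F x)) \<Longrightarrow> order_ge k (\<Sum>x\<in>K. F x)"
  by (induction K rule: infinite_finite_induct) (auto intro: order_ge_add)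

lemma order_ge_mono: "order_ge k f \<Longrightarrow> l \<le> k \<Longrightarrow> order_ge l f"
  by (auto simp: order_ge_def)

lemma order_ge_mult:
  assumes "order_ge k f" "order_ge l g"
  shows "order_ge (k + l) (f * g)"
  unfolding order_ge_def mps_coeff_mult
proof (intro allI impI sum.neutral ballI)
  fix m :: "nat \<Rightarrow>\<^sub>0 nat" and pq :: "(nat \<Rightarrow>\<^sub>0 nat) \<times> (nat \<Rightarrow>\<^sub>0 nat)"
  assume "total_deg m < k + l" and pq: "pq \<in> {(p, q). p + q = m}"
  then have "total_deg (fst pq) < k \<or> total_deg (snd pq) < l"
    by (auto simp: total_deg_add)
  then show "(case pq of (p, q) \<Rightarrow> mps_coeff f p * mps_coeff g q) = 0"
    using assms by (auto simp: order_ge_def split: prod.splits)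
qed

lemma order_ge_mult_left: "order_ge k g \<Longrightarrow> order_ge k (f * g)"
  using order_ge_mult[of 0 f k g] by simp

lemma order_ge_mult_right: "order_ge k f \<Longrightarrow> order_ge k (f * g)"
  using order_ge_mult[of k f 0 g] by simp

lemma order_ge_xvar: "order_ge 1 (xvar i)"
  by (auto simp: order_ge_def xvar_def)

lemma order_ge_xvar_power: "order_ge k (xvar i ^ k)"
proof (induction k)
  case (Suc k)
  then show ?case using order_ge_mult[OF order_ge_xvar[of i] Suc] by simp
qed simp

lemma order_ge_prod:
  "finite K \<Longrightarrow> (\<And>x. x \<in> K \<Longrightarrow> order_ge (k x) (F x)) \<Longrightarrow> order_ge (\<Sum>x\<in>K. k x) (\<Prod>x\<in>K. F x)"
  by (induction K rule: finite_induct) (auto intro: order_ge_mult)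

lemma mps_eq_0I: "(\<And>k. order_ge k f) \<Longrightarrow> f = 0"
  unfolding order_ge_def by (rule mps_eqI) (metis lessI mps_coeff_zero)

text \<open>If \<open>(x\<^sub>i - x\<^sub>j) f\<close> vanishes in low degrees, then coefficients of \<open>f\<close> do not change when a unit
  of the exponent is moved from \<open>x\<^sub>j\<close> to \<open>x\<^sub>i\<close>, and they vanish when no unit is left to be moved.\<close>

lemma order_ge_cancel_xvar_diff:
  assumes ij: "i \<ge> 1" "j \<ge> 1" "i \<noteq> j" and f: "order_ge (Suc k) ((xvar i - xvar j) * f)"
  shows "order_ge k f"
proof -
  let ?e = "\<lambda>i. Poly_Mapping.single (i - 1) (1 :: nat)"
  have ne: "i - 1 \<noteq> j - 1" using ij by auto
  have "mps_coeff f m = 0" if "total_deg m < k" "Poly_Mapping.lookup m (j - 1) = t" for m t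
    using that
  proof (induction t arbitrary: m)
    case 0
    have "mps_coeff ((xvar i - xvar j) * f) (m + ?e i) = 0"
      using f 0 by (simp add: order_ge_def total_deg_add)
    moreover have "mps_coeff (xvar j * f) (m + ?e i) = 0"
      using 0 ne by (intro mps_coeff_xvar_mult_0) (simp add: lookup_add lookup_single when_def)
    ultimately show ?case
      using mps_coeff_xvar_mult[of i f m] by (simp add: left_diff_distrib)
  next
    case (Suc t)
    then obtain m' where m: "m = m' + ?e j"
      using poly_mapping_split_single[of m "j - 1"] by auto
    have "mps_coeff ((xvar i - xvar j) * f) (m + ?e i) = 0"
      using f Suc by (simp add: order_ge_def total_deg_add)
    moreover have "mps_coeff (xvar j * f) (m + ?e i) = mps_coeff f (m' + ?e i)"
      using mps_coeff_xvar_mult[of j f "m' + ?e i"] by (simp add: m ac_simps)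
    moreover have "mps_coeff f (m' + ?e i) = 0"
      using Suc.prems m ne
      by (intro Suc.IH) (auto simp: total_deg_add lookup_add lookup_single when_def)
    ultimately show ?case
      using mps_coeff_xvar_mult[of i f m] by (simp add: left_diff_distrib)
  qed
  then show ?thesis by (simp add: order_ge_def)
qed

section \<open>Cancelling the Vandermonde product\<close>

definition vdm_pairs :: "nat \<Rightarrow> (nat \<times> nat) set" where
  "vdm_pairs n = (SIGMA j:{1..n}. {1..<j})"

lemma finite_vdm_pairs [simp]: "finite (vdm_pairs n)"
  by (simp add: vdm_pairs_def)

lemma card_vdm_pairs: "card (vdm_pairs n) = (\<Sum>j\<in>{1..n}. n - j)"
proof -
  have "card (vdm_pairs n) = (\<Sum>j\<in>{1..n}. j - 1)"
    by (simp add: vdm_pairs_def)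
  also have "\<dots> = (\<Sum>j\<in>{1..n}. n - j)"
    by (rule sum.reindex_bij_witness[where i = "\<lambda>j. Suc n - j" and j = "\<lambda>j. Suc n - j"]) auto
  finally show ?thesis .
qed

lemma vandermonde_pairs: "vandermonde n = (\<Prod>(j, i)\<in>vdm_pairs n. xvar i - xvar j)"
  unfolding vandermonde_def vdm_pairs_def by (subst prod.Sigma) auto

text \<open>Each factor \<open>xvar i - xvar j\<close> costs one degree. The induction runs over
  arbitrary subsets of the pairs, removing one factor at a time.\<close>

lemma order_ge_cancel_vandermonde:
  assumes "order_ge (k + card (vdm_pairs n)) (vandermonde n * f)"
  shows "order_ge k f"
proof -
  have "order_ge k f" if "finite P" "P \<subseteq> vdm_pairs n"
    "order_ge (k + card P) ((\<Prod>(j, i)\<in>P. xvar i - xvar j) * f)" for P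
    using that
  proof (induction P rule: finite_induct)
    case (insert ji P)
    obtain j i where ji: "ji = (j, i)" by force
    have "order_ge (k + card P) ((\<Prod>(j, i)\<in>P. xvar i - xvar j) * f)"
    proof (rule order_ge_cancel_xvar_diff)
      show "order_ge (Suc (k + card P)) ((xvar i - xvar j) * ((\<Prod>(j, i)\<in>P. xvar i - xvar j) * f))"
        using insert by (simp add: ji mult.assoc)
    qed (use insert.prems ji in \<open>auto simp: vdm_pairs_def\<close>)
    then show ?case using insert by auto
  qed auto
  from this[of "vdm_pairs n"] assms show ?thesis by (simp add: vandermonde_pairs)
qed

lemma vandermonde_cancel:
  assumes "f * vandermonde n = g * vandermonde n"
  shows "f = g"
proof -
  have "f - g = 0"
    by (rule mps_eq_0I, rule order_ge_cancel_vandermonde[of _ n])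
       (use assms in \<open>simp add: algebra_simps\<close>)
  then show ?thesis by simp
qed

lemma mps_quot_eqI:
  assumes "h * g = f" and "\<And>h'. h' * g = f \<Longrightarrow> h' = h"
  shows "mps_quot f g = h"
  unfolding mps_quot_def using assms by blast

lemma mps_quot_vandermonde: "h * vandermonde n = f \<Longrightarrow> mps_quot f (vandermonde n) = h"
  by (rule mps_quot_eqI) (auto intro: vandermonde_cancel)

lemma mps_quot_unit:
  assumes "g * u = 1"
  shows "mps_quot f g = f * u"
proof (rule mps_quot_eqI)
  show "f * u * g = f" using assms by (metis mult.assoc mult.commute mult_1_right)
  show "h' = f * u" if "h' * g = f" for h'
    using assms that by (metis mult.assoc mult_1_right)
qed

section \<open>Restriction to finitely many variables\<close>

lemma mps_coeff_restrict:
  "mps_coeff (mps_restrict n f) m = (if Poly_Mapping.keys m \<subseteq> {..<n} then mps_coeff f m else 0)"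
  by (simp add: mps_restrict_def)

lemma keys_add_nat: "Poly_Mapping.keys (p + q) = Poly_Mapping.keys p \<union> Poly_Mapping.keys (q :: nat \<Rightarrow>\<^sub>0 nat)"
  by (auto simp: in_keys_iff lookup_add)

lemma mps_restrict_0 [simp]: "mps_restrict n 0 = 0"
  by (rule mps_eqI) (simp add: mps_coeff_restrict)

lemma mps_restrict_1 [simp]: "mps_restrict n 1 = 1"
  by (rule mps_eqI) (simp add: mps_coeff_restrict mps_coeff_one)

lemma mps_restrict_add: "mps_restrict n (f + g) = mps_restrict n f + mps_restrict n g"
  by (rule mps_eqI) (simp add: mps_coeff_restrict)

lemma mps_restrict_diff: "mps_restrict n (f - g) = mps_restrict n f - mps_restrict n g"
  by (rule mps_eqI) (simp add: mps_coeff_restrict)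

lemma mps_restrict_mult: "mps_restrict n (f * g) = mps_restrict n f * mps_restrict n g"
proof (rule mps_eqI)
  fix m :: "nat \<Rightarrow>\<^sub>0 nat"
  show "mps_coeff (mps_restrict n (f * g)) m = mps_coeff (mps_restrict n f * mps_restrict n g) m"
  proof (cases "Poly_Mapping.keys m \<subseteq> {..<n}")
    case True
    then show ?thesis
      by (auto simp: mps_coeff_restrict mps_coeff_mult keys_add_nat intro!: sum.cong)
  next
    case False
    then have "(\<Sum>(p, q)\<in>{(p, q). p + q = m}.
        mps_coeff (mps_restrict n f) p * mps_coeff (mps_restrict n g) q) = 0"
      by (intro sum.neutral) (auto simp: mps_coeff_restrict keys_add_nat)
    with False show ?thesis
      by (simp add: mps_coeff_restrict mps_coeff_mult)
  qed
qed

lemma mps_restrict_hom: "comm_ring_hom (mps_restrict n)"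
  by unfold_locales (simp_all add: mps_restrict_add mps_restrict_mult)

lemma mps_restrict_power: "mps_restrict n (f ^ k) = mps_restrict n f ^ k"
  by (induction k) (auto simp: mps_restrict_mult)

lemma mps_restrict_prod: "mps_restrict n (\<Prod>k\<in>K. F k) = (\<Prod>k\<in>K. mps_restrict n (F k))"
  by (induction K rule: infinite_finite_induct) (auto simp: mps_restrict_mult)

lemma mps_restrict_restrict: "mps_restrict n (mps_restrict N f) = mps_restrict (min n N) f"
  by (rule mps_eqI) (auto simp: mps_coeff_restrict)

lemma mps_restrict_xvar:
  "i \<ge> 1 \<Longrightarrow> mps_restrict n (xvar i) = (if i \<le> n then xvar i else 0)"
  by (rule mps_eqI) (auto simp: mps_coeff_restrict xvar_def)

text \<open>The geometric series 1 + c x_i + c^2 x_i^2 + ..., the inverse of 1 - c x_i, given by its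
  coefficients.\<close>

definition geo :: "'a::comm_ring_1 \<Rightarrow> nat \<Rightarrow> 'a mps" where
  "geo c i = Abs_mps (\<lambda>m. if Poly_Mapping.keys m \<subseteq> {i - 1} then c ^ Poly_Mapping.lookup m (i - 1) else 0)"

lemma geo_inverse: "(1 - mps_const c * xvar i) * geo c i = 1"
proof (rule mps_eqI)
  fix m :: "nat \<Rightarrow>\<^sub>0 nat"
  let ?e = "Poly_Mapping.single (i - 1) (1 :: nat)"
  have *: "(1 - mps_const c * xvar i) * geo c i = geo c i - mps_const c * (xvar i * geo c i)"
    by (simp add: algebra_simps)
  show "mps_coeff ((1 - mps_const c * xvar i) * geo c i) m = mps_coeff 1 m"
  proof (cases "Poly_Mapping.lookup m (i - 1) = 0")
    case True
    then have "Poly_Mapping.keys m \<subseteq> {i - 1} \<longleftrightarrow> m = 0"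
      by (auto simp: in_keys_iff subset_singleton_iff simp flip: keys_eq_empty)
    with True show ?thesis
      unfolding * by (simp add: mps_coeff_xvar_mult_0 mps_coeff_one geo_def)
  next
    case False
    then obtain m' where m: "m = m' + ?e"
      using poly_mapping_split_single[of m "i - 1"] by auto
    then have "m \<noteq> 0" using False by auto
    then show ?thesis
      unfolding * using mps_coeff_xvar_mult[of i "geo c i" m'] m
      by (simp add: mps_coeff_one geo_def keys_add_nat lookup_add)
  qed
qed

section \<open>Alternants and Schur polynomials\<close>

definition ndet :: "nat \<Rightarrow> (nat \<Rightarrow> nat \<Rightarrow> 'a::comm_ring_1) \<Rightarrow> 'a" where
  "ndet n f = det (mat n n (\<lambda>(i, j). f (i + 1) (j + 1)))"

lemma ndet_cong:
  "(\<And>i j. i \<in> {1..n} \<Longrightarrow> j \<in> {1..n} \<Longrightarrow> f i j = g i j) \<Longrightarrow> ndet n f = ndet n g"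
  unfolding ndet_def by (intro arg_cong[where f = det] eq_matI) auto

lemma ndet_Leibniz:
  "ndet n f = (\<Sum>p | p permutes {0..<n}. signof p * (\<Prod>j\<in>{1..n}. f (Suc (p (j - 1))) j))"
  unfolding ndet_def det_col[OF mat_carrier]
proof (intro sum.cong refl arg_cong[where f = "\<lambda>x. _ * x"])
  fix p assume "p \<in> {p. p permutes {0..<n}}"
  then have p: "p j < n" if "j < n" for j
    using that permutes_in_image[of p "{0..<n}" j] by auto
  show "(\<Prod>j<n. mat n n (\<lambda>(i, j). f (i + 1) (j + 1)) $$ (p j, j)) = (\<Prod>j\<in>{1..n}. f (Suc (p (j - 1))) j)"
    by (rule prod.reindex_bij_witness[where i = "\<lambda>j. j - 1" and j = Suc]) (auto simp: p)
qed

lemma permutes_shift_in: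
  assumes "p permutes {0..<n}" "j \<in> {1..n}"
  shows "Suc (p (j - 1)) \<in> {1..n}"
proof -
  have "p (j - 1) < n"
    using permutes_in_image[OF assms(1), of "j - 1"] assms(2) by auto
  then show ?thesis by simp
qed

lemma ndet_scale: "ndet n (\<lambda>i j. c j * f i j) = (\<Prod>j\<in>{1..n}. c j) * ndet n f"
  unfolding ndet_Leibniz by (simp add: prod.distrib sum_distrib_left ac_simps)

lemma ndet_scale_row: "ndet n (\<lambda>i j. c i * f i j) = (\<Prod>i\<in>{1..n}. c i) * ndet n f"
proof -
  have "(\<Prod>j\<in>{1..n}. c (Suc (p (j - 1)))) = (\<Prod>i\<in>{1..n}. c i)" if p: "p permutes {0..<n}" for p
  proof (rule prod.reindex_bij_witness[where j = "\<lambda>j. Suc (p (j - 1))" and i = "\<lambda>i. Suc (Hilbert_Choice.inv p (i - 1))"])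
    fix j assume j: "j \<in> {1..n}"
    show "Suc (Hilbert_Choice.inv p (Suc (p (j - 1)) - 1)) = j" "Suc (p (j - 1)) \<in> {1..n}" "Suc (Hilbert_Choice.inv p (j - 1)) \<in> {1..n}"
      "Suc (p (Suc (Hilbert_Choice.inv p (j - 1)) - 1)) = j"
      using j permutes_shift_in[OF p j] permutes_shift_in[OF permutes_inv[OF p] j]
      by (auto simp: permutes_inverses[OF p])
  qed simp
  then show ?thesis
    unfolding ndet_Leibniz prod.distrib sum_distrib_left
    by (intro sum.cong refl) (simp only: mem_Collect_eq mult.left_commute)
qed

text \<open>The index functions of the expansion are extended by \<open>0\<close>, as are the parts of a partition.\<close>

lemma ndet_sum_columns:
  fixes f :: "nat \<Rightarrow> nat \<Rightarrow> nat \<Rightarrow> 'a::comm_ring_1"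
  assumes fin: "\<And>j. j \<in> {1..n} \<Longrightarrow> finite (Q j)"
  shows "ndet n (\<lambda>i j. \<Sum>q\<in>Q j. f i j q)
    = (\<Sum>g | (\<forall>j\<in>{1..n}. g j \<in> Q j) \<and> (\<forall>j. j \<notin> {1..n} \<longrightarrow> g j = 0). ndet n (\<lambda>i j. f i j (g j)))"
proof -
  have "ndet n (\<lambda>i j. \<Sum>q\<in>Q j. f i j q) = (\<Sum>g\<in>PiE {1..n} Q. ndet n (\<lambda>i j. f i j (g j)))"
    unfolding ndet_Leibniz
    by (subst prod_sum_PiE) (auto simp: fin sum_distrib_left intro: sum.swap)
  also have "\<dots> = (\<Sum>g | (\<forall>j\<in>{1..n}. g j \<in> Q j) \<and> (\<forall>j. j \<notin> {1..n} \<longrightarrow> g j = 0). ndet n (\<lambda>i j. f i j (g j)))"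
    by (rule sum.reindex_bij_witness[where
          j = "\<lambda>g j. if j \<in> {1..n} then g j else 0" and i = "\<lambda>g. restrict g {1..n}"])
       (auto simp: fun_eq_iff PiE_def extensional_def intro!: ndet_cong)
  finally show ?thesis .
qed

text \<open>The operations are simultaneous: every column loses a multiple of the original preceding
  column. This is multiplication from the right by a bidiagonal matrix with unit diagonal, whose
  determinant is 1.\<close>

lemma ndet_column_ops:
  "ndet n (\<lambda>i j. if j \<ge> 2 then f i j - t j * f i (j - 1) else f i j) = ndet n f"
proof -
  let ?A = "mat n n (\<lambda>(i, j). f (i + 1) (j + 1))"
  let ?E = "mat n n (\<lambda>(i, j). if i = j then 1 else if Suc i = j then - t (j + 1) else 0)"
  have E: "?E \<in> carrier_mat n n" by simp
  have "det ?E = prod_list (diag_mat ?E)"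
    by (rule det_upper_triangular[OF _ E]) (auto simp: upper_triangular_def)
  also have "\<dots> = 1"
    by (simp add: diag_mat_def prod.list_conv_set_nth)
  finally have detE: "det ?E = 1" .
  have "mat n n (\<lambda>(i, j). if j + 1 \<ge> 2 then f (i + 1) (j + 1) - t (j + 1) * f (i + 1) j else f (i + 1) (j + 1))
      = ?A * ?E"
  proof (rule eq_matI)
    fix i j assume ij: "i < dim_row (?A * ?E)" "j < dim_col (?A * ?E)"
    have "(?A * ?E) $$ (i, j)
        = (\<Sum>k\<in>{0..<n}. f (i + 1) (k + 1) * (if k = j then 1 else if Suc k = j then - t (j + 1) else 0))"
      using ij by (simp add: scalar_prod_def)
    also have "\<dots> = (\<Sum>k\<in>{0..<n}. (if k = j then f (i + 1) (k + 1) else 0)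
        + (if j \<ge> 1 \<and> k = j - 1 then - t (j + 1) * f (i + 1) (k + 1) else 0))"
      by (intro sum.cong) auto
    also have "\<dots> = f (i + 1) (j + 1) + (if j \<ge> 1 then - t (j + 1) * f (i + 1) j else 0)"
      using ij by (cases "j \<ge> 1") (auto simp: sum.distrib)
    finally show "mat n n (\<lambda>(i, j). if j + 1 \<ge> 2 then f (i + 1) (j + 1) - t (j + 1) * f (i + 1) j else f (i + 1) (j + 1)) $$ (i, j)
        = (?A * ?E) $$ (i, j)"
      using ij by auto
  qed auto
  moreover have "det (?A * ?E) = det ?A"
    using det_mult[of ?A n ?E] by (simp only: detE mat_carrier mult_1_right)
  ultimately show ?thesis
    by (simp only: ndet_def add_diff_cancel_right')
qed

lemma ndet_identical_columns:
  assumes "j \<in> {1..n}" "j' \<in> {1..n}" "j \<noteq> j'" "\<And>i. i \<in> {1..n} \<Longrightarrow> f i j = f i j'"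
  shows "ndet n f = 0"
  unfolding ndet_def
  by (rule det_identical_columns[of _ n "j - 1" "j' - 1"]) (use assms in \<open>auto intro!: eq_vecI\<close>)

lemma ndet_zero_row:
  assumes "i \<in> {1..n}" "\<And>j. j \<in> {1..n} \<Longrightarrow> f i j = 0"
  shows "ndet n f = 0"
proof -
  let ?A = "mat n n (\<lambda>(i, j). f (i + 1) (j + 1))"
  have "det ?A = (\<Sum>j<n. ?A $$ (i - 1, j) * cofactor ?A (i - 1) j)"
    by (rule laplace_expansion_row) (use assms(1) in auto)
  also have "\<dots> = 0"
    by (rule sum.neutral) (use assms in auto)
  finally show ?thesis by (simp add: ndet_def)
qed

lemma ndet_last_row_unit:
  assumes "\<And>j. j \<in> {1..n} \<Longrightarrow> f (Suc n) j = 0" "f (Suc n) (Suc n) = 1"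
  shows "ndet (Suc n) f = ndet n f"
proof -
  let ?A = "mat (Suc n) (Suc n) (\<lambda>(i, j). f (i + 1) (j + 1))"
  have "det ?A = (\<Sum>j<Suc n. ?A $$ (n, j) * cofactor ?A n j)"
    by (rule laplace_expansion_row) auto
  also have "\<dots> = cofactor ?A n n"
    using assms by simp
  also have "mat_delete ?A n n = mat n n (\<lambda>(i, j). f (i + 1) (j + 1))"
    by (rule eq_matI) (auto simp: mat_delete_def)
  then have "cofactor ?A n n = det (mat n n (\<lambda>(i, j). f (i + 1) (j + 1)))"
    by (simp add: cofactor_def power_add[symmetric])
  finally show ?thesis by (simp add: ndet_def)
qed

lemma (in comm_ring_hom) hom_ndet: "hom (ndet n f) = ndet n (\<lambda>i j. hom (f i j))"
  unfolding ndet_def hom_det[symmetric] by (intro arg_cong[where f = det] eq_matI) auto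

lemma order_ge_prod_diff:
  assumes "finite K" "\<And>x. x \<in> K \<Longrightarrow> order_ge k (F x - G x)"
  shows "order_ge k ((\<Prod>x\<in>K. F x) - (\<Prod>x\<in>K. G x))"
  using assms
proof (induction K rule: finite_induct)
  case (insert x K)
  have "(\<Prod>x\<in>insert x K. F x) - (\<Prod>x\<in>insert x K. G x)
      = (F x - G x) * (\<Prod>x\<in>K. F x) + G x * ((\<Prod>x\<in>K. F x) - (\<Prod>x\<in>K. G x))"
    using insert by (simp add: algebra_simps)
  then show ?case
    using insert by (simp only:) (intro order_ge_add order_ge_mult_left order_ge_mult_right; simp)
qed simp

lemma order_ge_ndet_diff:
  assumes "\<And>i j. i \<in> {1..n} \<Longrightarrow> j \<in> {1..n} \<Longrightarrow> order_ge k (f i j - g i j)"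
  shows "order_ge k (ndet n f - ndet n g)"
  unfolding ndet_Leibniz sum_subtractf[symmetric] right_diff_distrib[symmetric]
  by (intro order_ge_sum order_ge_mult_left order_ge_prod_diff assms permutes_shift_in) auto

lemma order_ge_ndet:
  assumes "\<And>i j. i \<in> {1..n} \<Longrightarrow> j \<in> {1..n} \<Longrightarrow> order_ge (k j) (f i j)"
  shows "order_ge (\<Sum>j\<in>{1..n}. k j) (ndet n f)"
  unfolding ndet_Leibniz
  by (intro order_ge_sum order_ge_mult_left order_ge_prod assms permutes_shift_in) auto

text \<open>Synthetic division of the quotient at the node \<open>x n\<close> splits off the next
  Newton coefficient as remainder. No divided differences occur, so the expansion exists over every
  commutative ring; at the nodes the last product kills the leftover \<open>q\<close>.\<close>

lemma Newton_expansion: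
  fixes p :: "'a::comm_ring_1 poly" and n :: nat
  shows "\<exists>u q. p = (\<Sum>k<n. smult (u k) (\<Prod>l<k. [:- x l, 1:])) + (\<Prod>l<n. [:- x l, 1:]) * q"
proof (induction n)
  case 0
  show ?case by simp
next
  case (Suc n)
  then obtain u q where p: "p = (\<Sum>k<n. smult (u k) (\<Prod>l<k. [:- x l, 1:])) + (\<Prod>l<n. [:- x l, 1:]) * q"
    by blast
  define u' where "u' = u(n := poly q (x n))"
  have q: "q = [:- x n, 1:] * synthetic_div q (x n) + [:poly q (x n):]"
    by (rule synthetic_div_correct'[symmetric])
  have "(\<Prod>l<n. [:- x l, 1:]) * q
      = smult (u' n) (\<Prod>l<n. [:- x l, 1:]) + (\<Prod>l<Suc n. [:- x l, 1:]) * synthetic_div q (x n)"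
    by (subst q) (simp add: u'_def algebra_simps)
  moreover have "(\<Sum>k<n. smult (u k) (\<Prod>l<k. [:- x l, 1:])) = (\<Sum>k<n. smult (u' k) (\<Prod>l<k. [:- x l, 1:]))"
    by (simp add: u'_def)
  ultimately have "p = (\<Sum>k<Suc n. smult (u' k) (\<Prod>l<k. [:- x l, 1:]))
      + (\<Prod>l<Suc n. [:- x l, 1:]) * synthetic_div q (x n)"
    using p by simp
  then show ?case by blast
qed

text \<open>By Newton interpolation the alternant is the product of a matrix with the lower triangular
  matrix with entries \<open>\<Prod>l<k. x\<^sub>i - x\<^sub>l\<close>.\<close>

lemma vandermonde_dvd_alternant: "vandermonde n dvd ndet n (\<lambda>i j. xvar i ^ e j)"
proof -
  define X :: "nat \<Rightarrow> Qa mps" where "X l = xvar (Suc l)" for l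
  define L where "L = mat n n (\<lambda>(i, k). \<Prod>l<k. X i - X l)"
  have "\<exists>u. \<forall>i<n. X i ^ m = (\<Sum>k<n. u k * (\<Prod>l<k. X i - X l))" for m
  proof -
    obtain u q where uq: "monom 1 m = (\<Sum>k<n. smult (u k) (\<Prod>l<k. [:- X l, 1:])) + (\<Prod>l<n. [:- X l, 1:]) * q"
      using Newton_expansion by blast
    have "X i ^ m = (\<Sum>k<n. u k * (\<Prod>l<k. X i - X l))" if "i < n" for i
    proof -
      have "(\<Prod>l<n. X i - X l) = 0"
        using that by (intro prod_zero) auto
      then show ?thesis
        using arg_cong[OF uq, of "\<lambda>p. poly p (X i)"]
        by (simp add: poly_monom poly_sum poly_prod)
    qed
    then show ?thesis by blast
  qed
  then have "\<exists>u. \<forall>m. \<forall>i<n. X i ^ m = (\<Sum>k<n. u m k * (\<Prod>l<k. X i - X l))"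
    by (intro choice allI)
  then obtain u where u: "\<And>m i. i < n \<Longrightarrow> X i ^ m = (\<Sum>k<n. u m k * (\<Prod>l<k. X i - X l))"
    by blast
  define U where "U = mat n n (\<lambda>(k, j). u (e (Suc j)) k)"
  have "mat n n (\<lambda>(i, j). xvar (i + 1) ^ e (j + 1)) = L * U"
    by (rule eq_matI)
       (auto simp: L_def U_def scalar_prod_def X_def[symmetric] u lessThan_atLeast0 mult.commute)
  then have "ndet n (\<lambda>i j. xvar i ^ e j) = det L * det U"
    using det_mult[of L n U] by (simp add: ndet_def L_def U_def)
  moreover have "det L = prod_list (diag_mat L)"
    by (rule det_lower_triangular[where n = n]) (auto simp: L_def intro!: prod_zero)
  moreover have "prod_list (diag_mat L) = (\<Prod>k<n. \<Prod>l<k. X k - X l)"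
    by (subst interv_sum_list_conv_sum_set_nat prod.list_conv_set_nth)+
       (auto simp: diag_mat_def L_def prod.list_conv_set_nth lessThan_atLeast0)
  \<comment> \<open>\<open>L\<close> produces the differences x_k - x_l with l < k, whose signs are
    opposite to those in \<open>vandermonde\<close>; the resulting sign does not affect
    divisibility.\<close>
  moreover have "(\<Prod>k<n. \<Prod>l<k. X k - X l) = (\<Prod>(j, i)\<in>vdm_pairs n. - (xvar i - xvar j))"
    unfolding prod.Sigma[OF finite_lessThan ballI[OF finite_lessThan]]
    by (rule prod.reindex_bij_witness[where i = "\<lambda>(j, i). (j - 1, i - 1)" and j = "\<lambda>(j, i). (Suc j, Suc i)"])
       (auto simp: X_def vdm_pairs_def)
  moreover have "(\<Prod>(j, i)\<in>vdm_pairs n. - (xvar i - xvar j)) = (- 1) ^ card (vdm_pairs n) * vandermonde n"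
    by (simp add: vandermonde_pairs split_def prod_uminus del: minus_diff_eq)
  ultimately show ?thesis
    by (metis dvd_triv_right dvd_mult2)
qed

lemma schur_poly_alternant:
  assumes "length \<nu> \<le> n"
  shows "schur_poly n \<nu> * vandermonde n = ndet n (\<lambda>i j. xvar i ^ (part \<nu> j + n - j))"
proof -
  obtain h where "ndet n (\<lambda>i j. xvar i ^ (part \<nu> j + n - j)) = vandermonde n * h"
    by (rule dvdE[OF vandermonde_dvd_alternant])
  then have h: "ndet n (\<lambda>i j. xvar i ^ (part \<nu> j + n - j)) = h * vandermonde n"
    by (simp only: mult.commute)
  with assms show ?thesis
    using mps_quot_vandermonde[of h n "ndet n (\<lambda>i j. xvar i ^ (part \<nu> j + n - j))"]
    by (simp add: schur_poly_def ndet_def)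
qed

section \<open>Stability of Schur polynomials and their limit\<close>

lemma mps_restrict_vandermonde_le: "n \<le> N \<Longrightarrow> mps_restrict N (vandermonde n) = vandermonde n"
  unfolding vandermonde_def mps_restrict_prod mps_restrict_diff
  by (intro prod.cong refl) (auto simp: mps_restrict_xvar)

lemma mps_restrict_vandermonde_Suc:
  "mps_restrict n (vandermonde (Suc n)) = vandermonde n * (\<Prod>i\<in>{1..n}. xvar i)"
proof -
  have "vandermonde (Suc n) = vandermonde n * (\<Prod>i\<in>{1..n}. xvar i - xvar (Suc n))"
    by (simp add: vandermonde_def atLeastLessThanSuc_atLeastAtMost)
  then show ?thesis
    by (auto simp: mps_restrict_mult mps_restrict_vandermonde_le mps_restrict_prod mps_restrict_diff
        mps_restrict_xvar intro!: prod.cong)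
qed

lemma mps_restrict_schur_poly_self: "mps_restrict n (schur_poly n \<nu>) = schur_poly n \<nu>"
proof (cases "length \<nu> \<le> n")
  case True
  have "mps_restrict n (schur_poly n \<nu>) * vandermonde n = mps_restrict n (schur_poly n \<nu> * vandermonde n)"
    by (simp add: mps_restrict_mult mps_restrict_vandermonde_le)
  also have "\<dots> = ndet n (\<lambda>i j. mps_restrict n (xvar i ^ (part \<nu> j + n - j)))"
    unfolding schur_poly_alternant[OF True] by (rule comm_ring_hom.hom_ndet[OF mps_restrict_hom])
  also have "\<dots> = ndet n (\<lambda>i j. xvar i ^ (part \<nu> j + n - j))"
    by (rule ndet_cong) (simp add: mps_restrict_power mps_restrict_xvar)
  finally show ?thesis
    unfolding schur_poly_alternant[OF True, symmetric] by (rule vandermonde_cancel)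
qed (simp add: schur_poly_def)

lemma xvar_prod_cancel:
  assumes "finite K" "f * (\<Prod>i\<in>K. xvar i) = g * (\<Prod>i\<in>K. xvar i)"
  shows "f = g"
  using assms
proof (induction K arbitrary: f g rule: finite_induct)
  case (insert i K)
  have "xvar i * f = xvar i * g"
  proof (rule insert.IH)
    show "xvar i * f * (\<Prod>i\<in>K. xvar i) = xvar i * g * (\<Prod>i\<in>K. xvar i)"
      using insert.prems by (simp add: insert.hyps mult.assoc mult.left_commute[of f] mult.left_commute[of g])
  qed
  then show ?case by (rule xvar_mult_cancel)
qed simp

lemma part_pos: "is_partition \<nu> \<Longrightarrow> 1 \<le> i \<Longrightarrow> i \<le> length \<nu> \<Longrightarrow> part \<nu> i > 0"
  by (auto simp: is_partition_def part_def) (metis Suc_pred gr0I less_eq_Suc_le nth_mem)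

lemma part_eq_0: "i > length \<nu> \<Longrightarrow> part \<nu> i = 0"
  by (simp add: part_def)

lemma part_0 [simp]: "part \<nu> 0 = 0"
  by (simp add: part_def)

text \<open>At x_{n+1} = 0 the Vandermonde product becomes that of n variables times x_1 ... x_n. If
  \<nu> has at most n parts, the last row of the alternant becomes (0, ..., 0, 1) and every other
  row i keeps an extra factor x_i, which cancels against that product. If \<nu> has n + 1 parts, the
  last row vanishes.\<close>

lemma mps_restrict_schur_poly_Suc:
  assumes \<nu>: "is_partition \<nu>"
  shows "mps_restrict n (schur_poly (Suc n) \<nu>) = schur_poly n \<nu>"
proof (cases "length \<nu> \<le> Suc n")
  case True
  let ?X = "\<Prod>i\<in>{1..n}. xvar i :: Qa mps"
  have "mps_restrict n (schur_poly (Suc n) \<nu>) * ?X * vandermonde n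
      = mps_restrict n (schur_poly (Suc n) \<nu> * vandermonde (Suc n))"
    by (simp add: mps_restrict_mult mps_restrict_vandermonde_Suc ac_simps)
  also have "\<dots> = ndet (Suc n) (\<lambda>i j. mps_restrict n (xvar i ^ (part \<nu> j + Suc n - j)))"
    unfolding schur_poly_alternant[OF True] by (rule comm_ring_hom.hom_ndet[OF mps_restrict_hom])
  also have "\<dots> = schur_poly n \<nu> * ?X * vandermonde n"
  proof (cases "length \<nu> \<le> n")
    case le: True
    have "ndet (Suc n) (\<lambda>i j. mps_restrict n (xvar i ^ (part \<nu> j + Suc n - j)))
        = ndet n (\<lambda>i j. mps_restrict n (xvar i ^ (part \<nu> j + Suc n - j)))"
      using le by (intro ndet_last_row_unit)
        (auto simp: mps_restrict_power mps_restrict_xvar part_eq_0 zero_power)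
    also have "\<dots> = ndet n (\<lambda>i j. xvar i * xvar i ^ (part \<nu> j + n - j))"
      by (rule ndet_cong) (auto simp: mps_restrict_power mps_restrict_xvar Suc_diff_le simp flip: power_Suc)
    also have "\<dots> = ?X * ndet n (\<lambda>i j. xvar i ^ (part \<nu> j + n - j))"
      by (rule ndet_scale_row)
    finally show ?thesis
      unfolding schur_poly_alternant[OF le, symmetric] by (simp only: ac_simps)
  next
    case False
    then have "part \<nu> (Suc n) > 0"
      using True \<nu> by (intro part_pos) auto
    then have "part \<nu> j + Suc n - j > 0" if "j \<le> Suc n" for j
      using that by (cases "j = Suc n") auto
    then have "ndet (Suc n) (\<lambda>i j. mps_restrict n (xvar i ^ (part \<nu> j + Suc n - j))) = 0"
      by (intro ndet_zero_row[of "Suc n"]) (auto simp: mps_restrict_power mps_restrict_xvar zero_power)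
    then show ?thesis using False by (simp add: schur_poly_def)
  qed
  finally have "mps_restrict n (schur_poly (Suc n) \<nu>) * ?X = schur_poly n \<nu> * ?X"
    by (rule vandermonde_cancel)
  then show ?thesis
    by (rule xvar_prod_cancel[rotated]) simp
qed (simp add: schur_poly_def)

lemma mps_restrict_schur_poly:
  assumes "is_partition \<nu>" "n \<le> N"
  shows "mps_restrict n (schur_poly N \<nu>) = schur_poly n \<nu>"
  using assms(2)
proof (induction N rule: dec_induct)
  case base
  show ?case by (rule mps_restrict_schur_poly_self)
next
  case (step N)
  then have "mps_restrict n (schur_poly (Suc N) \<nu>) = mps_restrict n (mps_restrict N (schur_poly (Suc N) \<nu>))"
    by (simp add: mps_restrict_restrict)
  with step show ?case by (simp add: mps_restrict_schur_poly_Suc[OF assms(1)])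
qed

lemma mps_eq_restrictI:
  assumes "\<And>n. mps_restrict n f = mps_restrict n g"
  shows "f = g"
proof (rule mps_eqI)
  fix m :: "nat \<Rightarrow>\<^sub>0 nat"
  obtain n where "\<forall>i\<in>Poly_Mapping.keys m. i < n"
    using finite_nat_set_iff_bounded[of "Poly_Mapping.keys m"] by auto
  then show "mps_coeff f m = mps_coeff g m"
    using arg_cong[OF assms[of n], of "\<lambda>f. mps_coeff f m"] by (simp add: mps_coeff_restrict subset_iff)
qed

text \<open>Existence of the limit must be shown before the definite description can be used: the
  coefficient of \<open>m\<close> is read off in \<open>N m\<close> variables, the fewest that
  contain \<open>m\<close>, and stability makes it agree with every larger number. Uniqueness holds
  since a monomial involves finitely many variables.\<close>

lemma mps_restrict_schur:
  assumes "is_partition \<nu>"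
  shows "mps_restrict n (schur \<nu>) = schur_poly n \<nu>"
proof -
  define N where "N m = (LEAST n. Poly_Mapping.keys m \<subseteq> {..<n})" for m :: "nat \<Rightarrow>\<^sub>0 nat"
  define f where "f = Abs_mps (\<lambda>m. mps_coeff (schur_poly (N m) \<nu>) m)"
  have f: "mps_restrict n f = schur_poly n \<nu>" for n
  proof (rule mps_eqI)
    fix m :: "nat \<Rightarrow>\<^sub>0 nat"
    show "mps_coeff (mps_restrict n f) m = mps_coeff (schur_poly n \<nu>) m"
    proof (cases "Poly_Mapping.keys m \<subseteq> {..<n}")
      case True
      then have "Poly_Mapping.keys m \<subseteq> {..<N m}" "N m \<le> n"
        unfolding N_def by (rule LeastI, rule Least_le)
      moreover have "mps_coeff (schur_poly (N m) \<nu>) m = mps_coeff (mps_restrict (N m) (schur_poly n \<nu>)) m"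
        using \<open>N m \<le> n\<close> by (simp add: mps_restrict_schur_poly[OF assms])
      ultimately show ?thesis
        using True by (simp add: mps_coeff_restrict f_def)
    next
      case False
      then show ?thesis
        by (subst mps_restrict_schur_poly_self[symmetric]) (simp add: mps_coeff_restrict)
    qed
  qed
  have "(\<forall>n. mps_restrict n (schur \<nu>) = schur_poly n \<nu>)"
    unfolding schur_def by (rule theI2[of _ f]) (auto simp: f intro: mps_eq_restrictI)
  then show ?thesis by blast
qed

section \<open>Degrees of Schur functions\<close>

lemma sum_part:
  assumes "length \<nu> \<le> n"
  shows "(\<Sum>j\<in>{1..n}. part \<nu> j) = sum_list \<nu>"
proof -
  have "(\<Sum>j\<in>{1..n}. part \<nu> j) = (\<Sum>j\<in>{1..length \<nu>}. part \<nu> j)"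
    using assms by (intro sum.mono_neutral_right) (auto simp: part_eq_0)
  also have "\<dots> = (\<Sum>j<length \<nu>. \<nu> ! j)"
    by (rule sum.reindex_bij_witness[where i = Suc and j = "\<lambda>j. j - 1"]) (auto simp: part_def)
  finally show ?thesis by (simp add: sum_list_sum_nth lessThan_atLeast0)
qed

text \<open>Each Leibniz term of the alternant has order at least |\<nu>| + (n - 1) + ... + 0, and
  cancelling the Vandermonde product costs the second part.\<close>

lemma order_ge_schur_poly: "order_ge (sum_list \<nu>) (schur_poly n \<nu>)"
proof (cases "length \<nu> \<le> n")
  case True
  have "order_ge (\<Sum>j\<in>{1..n}. part \<nu> j + n - j) (vandermonde n * schur_poly n \<nu>)"
    unfolding mult.commute[of "vandermonde n"] schur_poly_alternant[OF True]
    by (intro order_ge_ndet order_ge_xvar_power)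
  moreover have "(\<Sum>j\<in>{1..n}. part \<nu> j + n - j) = sum_list \<nu> + card (vdm_pairs n)"
    unfolding card_vdm_pairs sum_part[OF True, symmetric] sum.distrib[symmetric]
    by (intro sum.cong) auto
  ultimately show ?thesis by (auto intro: order_ge_cancel_vandermonde)
qed (simp add: schur_poly_def)

lemma mps_coeff_schur:
  assumes "is_partition \<nu>" "Poly_Mapping.keys m \<subseteq> {..<n}"
  shows "mps_coeff (schur \<nu>) m = mps_coeff (schur_poly n \<nu>) m"
  using assms by (simp add: mps_restrict_schur[symmetric] mps_coeff_restrict)

lemma order_ge_schur:
  assumes "is_partition \<nu>"
  shows "order_ge (sum_list \<nu>) (schur \<nu>)"
  unfolding order_ge_def
proof (intro allI impI)
  fix m :: "nat \<Rightarrow>\<^sub>0 nat" assume "total_deg m < sum_list \<nu>"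
  moreover obtain n where "\<forall>i\<in>Poly_Mapping.keys m. i < n"
    using finite_nat_set_iff_bounded[of "Poly_Mapping.keys m"] by auto
  ultimately show "mps_coeff (schur \<nu>) m = 0"
    using order_ge_schur_poly[of \<nu> n] mps_coeff_schur[OF assms, of m n]
    by (auto simp: order_ge_def)
qed

lemma finite_partitions_bounded: "finite {\<nu>. is_partition \<nu> \<and> sum_list \<nu> \<le> D}"
proof (rule finite_subset)
  show "{\<nu>. is_partition \<nu> \<and> sum_list \<nu> \<le> D} \<subseteq> {\<nu>. set \<nu> \<subseteq> {..D} \<and> length \<nu> \<le> D}"
  proof safe
    fix \<nu> :: "nat list" assume \<nu>: "is_partition \<nu>" "sum_list \<nu> \<le> D"
    show "x \<le> D" if "x \<in> set \<nu>" for x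
      using member_le_sum_list[OF that] \<nu> by simp
    have "length \<nu> \<le> sum_list \<nu>" if "0 \<notin> set \<nu>"
      using that by (induction \<nu>) auto
    with \<nu> show "length \<nu> \<le> D" by (auto simp: is_partition_def)
  qed
qed (rule finite_lists_length_le, simp)

section \<open>Removing the last letter from a tableau\<close>

lemma downclosed_eq_atLeastAtMost:
  assumes "finite S" "0 \<notin> S" "\<And>i j. j \<in> S \<Longrightarrow> 1 \<le> i \<Longrightarrow> i \<le> j \<Longrightarrow> i \<in> S"
  shows "S = {1..card S}"
proof (cases "S = {}")
  case False
  have "S = {1..Max S}"
    using assms Max_in[OF assms(1) False] Max_ge[OF assms(1)]
    by (auto simp: Suc_le_eq) (metis gr0I)
  then show ?thesis by (metis card_atLeastAtMost diff_Suc_1 One_nat_def)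
qed simp

lemma part_antimono:
  assumes "is_partition \<mu>" "1 \<le> i" "i \<le> j"
  shows "part \<mu> j \<le> part \<mu> i"
proof (cases "i < j \<and> j \<le> length \<mu>")
  case True
  then have "\<mu> ! (j - 1) \<le> \<mu> ! (i - 1)"
    using assms by (intro sorted_wrt_nth_less[of "(\<ge>)" \<mu>]) (auto simp: is_partition_def)
  then show ?thesis using True assms by (simp add: part_def)
qed (use assms in \<open>auto simp: part_def\<close>)

lemma diag_len_iff:
  assumes "is_partition \<mu>" "1 \<le> i"
  shows "i \<le> diag_len \<mu> \<longleftrightarrow> i \<le> part \<mu> i"
proof -
  let ?S = "{i. (i, i) \<in> diagram \<mu>}"
  have "i \<in> {1..length \<mu>}" if "i \<in> ?S" for i
    using that part_eq_0[of \<mu> i] by (cases "i \<le> length \<mu>") (auto simp: diagram_def)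
  then have "finite ?S" by (meson finite_atLeastAtMost finite_subset subsetI)
  moreover have "i \<in> ?S" if "j \<in> ?S" "1 \<le> i" "i \<le> j" for i j
    using that part_antimono[OF assms(1), of i j] by (auto simp: diagram_def)
  ultimately have "?S = {1..diag_len \<mu>}"
    unfolding diag_len_def by (intro downclosed_eq_atLeastAtMost) (auto simp: diagram_def)
  then have "i \<in> ?S \<longleftrightarrow> i \<in> {1..diag_len \<mu>}" by (rule arg_cong)
  with assms(2) show ?thesis by (auto simp: diagram_def)
qed

text \<open>The letters \<open>\<dots>, a\<^sub>-\<^sub>1, a\<^sub>0, a\<^sub>n, \<dots>, a\<^sub>1\<close> are treated in this order; the letter at position
  \<open>s > 0\<close> is \<open>a\<^sub>n\<^sub>+\<^sub>1\<^sub>-\<^sub>s\<close>.  In terms of positions, the entries in the first \<open>d\<close> rows and those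
  in the other rows satisfy conditions of the same kind, with the interval \<open>{lo i..hi i}\<close> of admissible
  positions in row \<open>i\<close>.\<close>

locale dual_schur_setup =
  fixes \<mu> :: "nat list" and n :: nat
  assumes mu: "is_partition \<mu>" and len: "length \<mu> \<le> n"
begin

abbreviation d :: nat where "d \<equiv> diag_len \<mu>"

text \<open>Both the first position among the factors of column \<open>i\<close> of the determinant
  and the least entry allowed in row \<open>i\<close> of a tableau. For \<open>i > d\<close> the
  column carries a_k with 1 <= k <= i - mu_i - 1; the largest k comes earliest, at position n + 1 -
  (i - mu_i - 1).\<close>

definition lo :: "nat \<Rightarrow> int" where
  "lo i = (if i \<le> d then int i - int (part \<mu> i) else int n + 2 - int i + int (part \<mu> i))"

definition hi :: "nat \<Rightarrow> int" where
  "hi i = (if i \<le> d then 0 else int n)"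

text \<open>The sign at positive positions is that of a_k in the factor 1 - a_k x; collected over
  the boxes below row \<open>d\<close> it becomes the sign of the expansion.\<close>

definition letter_weight :: "int \<Rightarrow> Qa" where
  "letter_weight s = (if s \<le> 0 then avar s else - avar (int n + 1 - s))"

text \<open>Row lengths of the diagrams of the expansion, with at most \<open>n\<close> rows and cut
  off at \<open>B\<close> columns. Together with containing mu, the last condition fixes the length
  of the diagonal. Functions extended by 0 are used because choices of one exponent per column are
  of this type already.\<close>

definition shapes :: "nat \<Rightarrow> (nat \<Rightarrow> nat) set" where
  "shapes B = {\<rho>. (\<forall>i. i \<notin> {1..n} \<longrightarrow> \<rho> i = 0) \<and> (\<forall>i. part \<mu> i \<le> \<rho> i) \<and> (\<forall>i. \<rho> i \<le> B) \<and>
     (\<forall>i j. 1 \<le> i \<and> i \<le> j \<longrightarrow> \<rho> j \<le> \<rho> i) \<and> (\<forall>i. d < i \<longrightarrow> \<rho> i \<le> d)}"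

definition boxes :: "(nat \<Rightarrow> nat) \<Rightarrow> (nat \<times> nat) set" where
  "boxes \<rho> = {(i, j). part \<mu> i < j \<and> j \<le> \<rho> i}"

text \<open>No condition links a row up to \<open>d\<close> with a row beyond \<open>d\<close>:
  outside mu, the former has boxes only in columns beyond \<open>d\<close>, and the latter, in a
  shape, only in columns up to \<open>d\<close>.\<close>

definition position_tableaux :: "int \<Rightarrow> (nat \<Rightarrow> nat) \<Rightarrow> (nat \<times> nat \<Rightarrow> int) set" where
  "position_tableaux s \<rho> = {U \<in> extensional (boxes \<rho>).
     (\<forall>i j. (i, j) \<in> boxes \<rho> \<longrightarrow> lo i \<le> U (i, j) \<and> U (i, j) \<le> hi i \<and> U (i, j) \<le> s) \<and>
     (\<forall>i j l. (i, j) \<in> boxes \<rho> \<and> (i, l) \<in> boxes \<rho> \<and> j < l \<longrightarrow>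
        (i \<le> d \<longrightarrow> U (i, j) \<le> U (i, l)) \<and> (d < i \<longrightarrow> U (i, j) < U (i, l))) \<and>
     (\<forall>i k j. (i, j) \<in> boxes \<rho> \<and> (k, j) \<in> boxes \<rho> \<and> i < k \<longrightarrow>
        (k \<le> d \<longrightarrow> U (i, j) < U (k, j)) \<and> (d < i \<longrightarrow> U (i, j) \<le> U (k, j)))}"

definition tableau_sum :: "int \<Rightarrow> (nat \<Rightarrow> nat) \<Rightarrow> Qa" where
  "tableau_sum s \<rho> = (\<Sum>U\<in>position_tableaux s \<rho>. \<Prod>\<alpha>\<in>boxes \<rho>. letter_weight (U \<alpha>))"

text \<open>Rows up to \<open>d\<close> grow by a horizontal strip, rows beyond \<open>d\<close> by
  at most one box each, and only where position \<open>s\<close> is admissible. The first row has no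
  row above it to limit its growth, hence \<open>2 \<le> i\<close>.\<close>

definition strip :: "int \<Rightarrow> (nat \<Rightarrow> nat) \<Rightarrow> (nat \<Rightarrow> nat) \<Rightarrow> bool" where
  "strip s \<rho> \<delta> \<longleftrightarrow> (\<forall>i. \<rho> i \<le> \<delta> i \<and> (\<rho> i < \<delta> i \<longrightarrow> lo i \<le> s \<and> s \<le> hi i \<and>
     (i \<le> d \<and> 2 \<le> i \<longrightarrow> \<delta> i \<le> \<rho> (i - 1)) \<and> (d < i \<longrightarrow> \<delta> i \<le> \<rho> i + 1)))"

lemma shapesD:
  assumes "\<rho> \<in> shapes B"
  shows "i \<notin> {1..n} \<Longrightarrow> \<rho> i = 0" "part \<mu> i \<le> \<rho> i" "\<rho> i \<le> B"
    "1 \<le> i \<Longrightarrow> i \<le> j \<Longrightarrow> \<rho> j \<le> \<rho> i" "d < i \<Longrightarrow> \<rho> i \<le> d"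
  using assms by (auto simp: shapes_def)

lemma part_ge_d: "1 \<le> i \<Longrightarrow> i \<le> d \<Longrightarrow> d \<le> part \<mu> i"
  using diag_len_iff[OF mu, of d] part_antimono[OF mu, of i d] by (auto intro: order_trans)

lemma part_lt: "d < i \<Longrightarrow> part \<mu> i < i"
  using diag_len_iff[OF mu, of i] by auto

lemma finite_shapes [simp]: "finite (shapes B)"
proof (rule finite_subset)
  show "shapes B \<subseteq> (\<lambda>g i. if i \<in> {1..n} then g i else 0) ` (PiE {1..n} (\<lambda>_. {..B}))"
  proof
    fix \<rho> assume "\<rho> \<in> shapes B"
    then have "\<rho> = (\<lambda>i. if i \<in> {1..n} then restrict \<rho> {1..n} i else 0)" "restrict \<rho> {1..n} \<in> PiE {1..n} (\<lambda>_. {..B})"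
      using shapesD[of \<rho> B] by (auto simp: fun_eq_iff)
    then show "\<rho> \<in> (\<lambda>g i. if i \<in> {1..n} then g i else 0) ` (PiE {1..n} (\<lambda>_. {..B}))"
      by (rule image_eqI)
  qed
qed (intro finite_imageI finite_PiE; simp)

lemma in_boxes: "(i, j) \<in> boxes \<rho> \<longleftrightarrow> part \<mu> i < j \<and> j \<le> \<rho> i"
  by (simp add: boxes_def)

lemma boxes_Sigma:
  assumes "\<rho> \<in> shapes B"
  shows "boxes \<rho> = (SIGMA i:{1..n}. {part \<mu> i<..\<rho> i})"
  using shapesD(1)[OF assms] by (force simp: boxes_def)

lemma finite_boxes: "\<rho> \<in> shapes B \<Longrightarrow> finite (boxes \<rho>)"
  by (simp add: boxes_Sigma)

lemma finite_position_tableaux: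
  assumes "\<rho> \<in> shapes B"
  shows "finite (position_tableaux s \<rho>)"
proof (rule finite_subset)
  show "position_tableaux s \<rho> \<subseteq> PiE (boxes \<rho>) (\<lambda>(i, j). {lo i..s})"
    by (auto simp: position_tableaux_def PiE_def)
qed (intro finite_PiE finite_boxes[OF assms]; auto)

lemma position_tableauxD:
  assumes "U \<in> position_tableaux s \<rho>"
  shows "U \<in> extensional (boxes \<rho>)"
    "(i, j) \<in> boxes \<rho> \<Longrightarrow> lo i \<le> U (i, j)" "(i, j) \<in> boxes \<rho> \<Longrightarrow> U (i, j) \<le> hi i"
    "(i, j) \<in> boxes \<rho> \<Longrightarrow> U (i, j) \<le> s"
    "(i, j) \<in> boxes \<rho> \<Longrightarrow> (i, l) \<in> boxes \<rho> \<Longrightarrow> j < l \<Longrightarrow> i \<le> d \<Longrightarrow> U (i, j) \<le> U (i, l)"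
    "(i, j) \<in> boxes \<rho> \<Longrightarrow> (i, l) \<in> boxes \<rho> \<Longrightarrow> j < l \<Longrightarrow> d < i \<Longrightarrow> U (i, j) < U (i, l)"
    "(i, j) \<in> boxes \<rho> \<Longrightarrow> (k, j) \<in> boxes \<rho> \<Longrightarrow> i < k \<Longrightarrow> k \<le> d \<Longrightarrow> U (i, j) < U (k, j)"
    "(i, j) \<in> boxes \<rho> \<Longrightarrow> (k, j) \<in> boxes \<rho> \<Longrightarrow> i < k \<Longrightarrow> d < i \<Longrightarrow> U (i, j) \<le> U (k, j)"
  using assms unfolding position_tableaux_def by blast+

section \<open>Erasing and restoring the entries equal to the last position\<close>

definition cut :: "int \<Rightarrow> (nat \<Rightarrow> nat) \<Rightarrow> (nat \<times> nat \<Rightarrow> int) \<Rightarrow> nat \<Rightarrow> nat" where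
  "cut s \<delta> U i = card {j \<in> {1..\<delta> i}. j \<le> part \<mu> i \<or> U (i, j) < s}"

definition fill_up :: "int \<Rightarrow> (nat \<Rightarrow> nat) \<Rightarrow> (nat \<Rightarrow> nat) \<Rightarrow> (nat \<times> nat \<Rightarrow> int) \<Rightarrow> nat \<times> nat \<Rightarrow> int" where
  "fill_up s \<delta> \<rho> V \<alpha> = (if \<alpha> \<in> boxes \<rho> then V \<alpha> else if \<alpha> \<in> boxes \<delta> then s else undefined)"

text \<open>Entries increase along every row, weakly or strictly, so the boxes of mu and those with
  entries below \<open>s\<close> fill an initial segment of the row, whose cardinality is its last
  column.\<close>

lemma le_cut_iff:
  assumes "\<delta> \<in> shapes B" "U \<in> position_tableaux s \<delta>" "1 \<le> j"
  shows "j \<le> cut s \<delta> U i \<longleftrightarrow> j \<le> \<delta> i \<and> (j \<le> part \<mu> i \<or> U (i, j) < s)"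
proof -
  let ?S = "{j \<in> {1..\<delta> i}. j \<le> part \<mu> i \<or> U (i, j) < s}"
  have row: "U (i, j) \<le> U (i, l)" if "(i, j) \<in> boxes \<delta>" "(i, l) \<in> boxes \<delta>" "j < l" for j l
    using position_tableauxD(5,6)[OF assms(2) that] by (cases "i \<le> d") auto
  have "j \<in> ?S" if "l \<in> ?S" "1 \<le> j" "j \<le> l" for j l
    using that row[of j l] by (cases "j \<le> part \<mu> i"; cases "j = l") (auto simp: in_boxes)
  then have "?S = {1..card ?S}"
    by (intro downclosed_eq_atLeastAtMost) auto
  then have "j \<in> ?S \<longleftrightarrow> j \<in> {1..cut s \<delta> U i}" unfolding cut_def by (rule arg_cong)
  with assms(3) show ?thesis by auto
qed

lemma in_boxes_cut:
  assumes "\<delta> \<in> shapes B" "U \<in> position_tableaux s \<delta>"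
  shows "(i, j) \<in> boxes (cut s \<delta> U) \<longleftrightarrow> (i, j) \<in> boxes \<delta> \<and> U (i, j) < s"
  using le_cut_iff[OF assms, of j i] by (cases "j = 0") (auto simp: in_boxes)

lemma cut_le:
  assumes "\<delta> \<in> shapes B" "U \<in> position_tableaux s \<delta>"
  shows "cut s \<delta> U i \<le> \<delta> i"
  using le_cut_iff[OF assms, of "cut s \<delta> U i" i] by (cases "cut s \<delta> U i = 0") auto

lemma part_le_cut:
  assumes "\<delta> \<in> shapes B" "U \<in> position_tableaux s \<delta>"
  shows "part \<mu> i \<le> cut s \<delta> U i"
  using le_cut_iff[OF assms, of "part \<mu> i" i] shapesD(2)[OF assms(1), of i]
  by (cases "part \<mu> i = 0") auto

lemma cut_in_shapes:
  assumes \<delta>: "\<delta> \<in> shapes B" and U: "U \<in> position_tableaux s \<delta>"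
  shows "cut s \<delta> U \<in> shapes B"
proof -
  have "cut s \<delta> U k \<le> cut s \<delta> U i" if ik: "1 \<le> i" "i \<le> k" for i k
  proof (cases "cut s \<delta> U k \<le> part \<mu> i \<or> i = k")
    case True
    then show ?thesis using part_le_cut[OF assms, of i] by auto
  next
    case False
    define j where "j = cut s \<delta> U k"
    have j: "part \<mu> i < j" "part \<mu> k < j" "i < k"
      using False ik part_antimono[OF mu ik] by (auto simp: j_def)
    then have kj: "(k, j) \<in> boxes \<delta>" "U (k, j) < s"
      using in_boxes_cut[OF assms, of k j] by (auto simp: in_boxes j_def)
    moreover have ij: "(i, j) \<in> boxes \<delta>"
      using j kj shapesD(4)[OF \<delta> ik] by (auto simp: in_boxes)
    \<comment> \<open>A column shared by a row up to \<open>d\<close> and a row beyond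
      \<open>d\<close> would lie on both sides of \<open>d\<close>; so one of the two column
      conditions applies.\<close>
    moreover have "\<not> (i \<le> d \<and> d < k)"
      using part_ge_d[of i] ik j kj shapesD(5)[OF \<delta>, of k] by (auto simp: in_boxes)
    ultimately have "U (i, j) < s"
      using position_tableauxD(7,8)[OF U ij kj(1) \<open>i < k\<close>] by linarith
    with ij have "(i, j) \<in> boxes (cut s \<delta> U)" by (simp add: in_boxes_cut[OF assms])
    then show ?thesis by (simp add: in_boxes j_def)
  qed
  moreover have "cut s \<delta> U i = 0" if "i \<notin> {1..n}" for i
    using shapesD(1)[OF \<delta> that] cut_le[OF assms, of i] by simp
  ultimately show ?thesis
    using part_le_cut[OF assms] cut_le[OF assms] shapesD(3,5)[OF \<delta>]
    unfolding shapes_def by (blast intro: order_trans)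
qed

text \<open>In rows up to \<open>d\<close> the columns are strict, so above an erased entry stands a
  smaller entry or a box of mu, which stays. A row beyond \<open>d\<close> is strict itself, so it
  contains \<open>s\<close> at most once.\<close>

lemma strip_cut:
  assumes \<delta>: "\<delta> \<in> shapes B" and U: "U \<in> position_tableaux s \<delta>"
  shows "strip s (cut s \<delta> U) \<delta>"
  unfolding strip_def
proof (intro allI conjI impI)
  fix i
  show "cut s \<delta> U i \<le> \<delta> i" by (rule cut_le[OF assms])
  assume lt: "cut s \<delta> U i < \<delta> i"
  have eq_s: "(i, j) \<in> boxes \<delta> \<and> U (i, j) = s" if "cut s \<delta> U i < j" "j \<le> \<delta> i" for j
  proof -
    have "(i, j) \<in> boxes \<delta>" "(i, j) \<notin> boxes (cut s \<delta> U)"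
      using that part_le_cut[OF assms, of i] by (auto simp: in_boxes)
    with in_boxes_cut[OF assms, of i j] position_tableauxD(4)[OF U, of i j] show ?thesis by auto
  qed
  note last = eq_s[OF lt order_refl]
  show "lo i \<le> s" "s \<le> hi i"
    using last position_tableauxD(2,3)[OF U, of i "\<delta> i"] by auto
  show "\<delta> i \<le> cut s \<delta> U (i - 1)" if i: "i \<le> d \<and> 2 \<le> i"
  proof (cases "\<delta> i \<le> part \<mu> (i - 1)")
    case True
    then show ?thesis using part_le_cut[OF assms, of "i - 1"] by simp
  next
    case False
    then have "(i - 1, \<delta> i) \<in> boxes \<delta>"
      using shapesD(4)[OF \<delta>, of "i - 1" i] i by (auto simp: in_boxes)
    moreover from this have "U (i - 1, \<delta> i) < s"
      using position_tableauxD(7)[OF U, of "i - 1" "\<delta> i" i] last i by auto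
    ultimately have "(i - 1, \<delta> i) \<in> boxes (cut s \<delta> U)"
      by (simp add: in_boxes_cut[OF assms])
    then show ?thesis by (simp add: in_boxes)
  qed
  show "\<delta> i \<le> cut s \<delta> U i + 1" if i: "d < i"
  proof (rule ccontr)
    assume *: "\<not> \<delta> i \<le> cut s \<delta> U i + 1"
    with eq_s[of "cut s \<delta> U i + 1"] last show False
      using position_tableauxD(6)[OF U, of i "cut s \<delta> U i + 1" "\<delta> i"] i by auto
  qed
qed

lemma restrict_cut_tableau:
  assumes \<delta>: "\<delta> \<in> shapes B" and U: "U \<in> position_tableaux s \<delta>"
  shows "restrict U (boxes (cut s \<delta> U)) \<in> position_tableaux (s - 1) (cut s \<delta> U)"
  using position_tableauxD(2-)[OF U]
  unfolding position_tableaux_def by (auto simp: in_boxes_cut[OF assms])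

lemma boxes_mono: "strip s \<rho> \<delta> \<Longrightarrow> boxes \<rho> \<subseteq> boxes \<delta>"
  by (auto simp: strip_def boxes_def intro: order_trans)

text \<open>All entries of \<open>V\<close> are below \<open>s\<close>, so the weak inequalities
  survive by themselves. The strip conditions supply the strict ones: in rows up to \<open>d\<close>
  no two new boxes share a column, beyond \<open>d\<close> no two share a row.\<close>

lemma fill_up_tableau:
  assumes \<rho>: "\<rho> \<in> shapes B" and \<delta>: "\<delta> \<in> shapes B" and st: "strip s \<rho> \<delta>"
    and V: "V \<in> position_tableaux (s - 1) \<rho>"
  shows "fill_up s \<delta> \<rho> V \<in> position_tableaux s \<delta>"
proof -
  note stD = st[unfolded strip_def, rule_format]
  note VD = position_tableauxD[OF V]
  have new: "\<rho> i < j \<and> \<rho> i < \<delta> i \<and> j \<le> \<delta> i" if "(i, j) \<in> boxes \<delta>" "(i, j) \<notin> boxes \<rho>" for i j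
    using that by (auto simp: in_boxes)
  let ?U = "fill_up s \<delta> \<rho> V"
  have U_new: "?U (i, j) = s" if "(i, j) \<in> boxes \<delta>" "(i, j) \<notin> boxes \<rho>" for i j
    using that by (simp add: fill_up_def)
  have U_old: "?U (i, j) = V (i, j)" "?U (i, j) < s" if "(i, j) \<in> boxes \<rho>" for i j
    using VD(4)[OF that] that by (auto simp: fill_up_def)
  have le: "?U (i, j) \<le> s" if "(i, j) \<in> boxes \<delta>" for i j
    using U_new[OF that] U_old(2)[of i j] by fastforce
  show ?thesis
    unfolding position_tableaux_def
  proof (intro CollectI conjI allI impI; (elim conjE)?)
    show "?U \<in> extensional (boxes \<delta>)"
      using boxes_mono[OF st] by (auto simp: extensional_def fill_up_def)
  next
    fix i j assume ij: "(i, j) \<in> boxes \<delta>"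
    show "?U (i, j) \<le> s" by (rule le[OF ij])
    show "lo i \<le> ?U (i, j)" "?U (i, j) \<le> hi i"
      using U_new[OF ij] U_old(1)[of i j] VD(2,3)[of i j] new[OF ij] stD[of i] by fastforce+
  next
    fix i j l assume *: "(i, j) \<in> boxes \<delta>" "(i, l) \<in> boxes \<delta>" "j < l"
    have old: "(i, j) \<in> boxes \<rho>" if "(i, l) \<in> boxes \<rho>"
      using * that by (auto simp: in_boxes)
    show "?U (i, j) \<le> ?U (i, l)" if "i \<le> d"
      using le[OF *(1)] U_new[OF *(2)] U_old(1)[of i l] U_old(1)[of i j] VD(5)[of i j l] old * that by fastforce
    show "?U (i, j) < ?U (i, l)" if "d < i"
    proof (cases "(i, l) \<in> boxes \<rho>")
      case True
      then show ?thesis using VD(6)[of i j l] old * that by (simp add: U_old)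
    next
      case False
      then have "(i, j) \<in> boxes \<rho>"
        using new[OF *(2)] *(1,3) stD[of i] that by (auto simp: in_boxes)
      then show ?thesis using U_old(2) U_new[OF *(2) False] by auto
    qed
  next
    fix i k j assume *: "(i, j) \<in> boxes \<delta>" "(k, j) \<in> boxes \<delta>" "i < k"
    then have i: "1 \<le> i" using shapesD(1)[OF \<delta>, of i] by (cases "i = 0") (auto simp: in_boxes)
    have old: "(i, j) \<in> boxes \<rho>" if "(k, j) \<in> boxes \<rho>"
      using * that shapesD(4)[OF \<rho>, of i k] i by (auto simp: in_boxes)
    show "?U (i, j) < ?U (k, j)" if "k \<le> d"
    proof (cases "(k, j) \<in> boxes \<rho>")
      case True
      then show ?thesis using VD(7)[of i j k] old * that by (simp add: U_old)
    next
      case False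
      then have "j \<le> \<rho> (k - 1)"
        using new[OF *(2)] stD[of k] that i *(3) by auto
      then have "(i, j) \<in> boxes \<rho>"
        using * shapesD(4)[OF \<rho>, of i "k - 1"] i by (auto simp: in_boxes less_imp_le_nat intro: order_trans)
      then show ?thesis using U_old(2) U_new[OF *(2) False] by auto
    qed
    show "?U (i, j) \<le> ?U (k, j)" if "d < i"
      using le[OF *(1)] U_new[OF *(2)] U_old(1)[of k j] U_old(1)[of i j] VD(8)[of i j k] old * that by fastforce
  qed
qed

lemma cut_fill_up:
  assumes \<rho>: "\<rho> \<in> shapes B" and \<delta>: "\<delta> \<in> shapes B" and st: "strip s \<rho> \<delta>"
    and V: "V \<in> position_tableaux (s - 1) \<rho>"
  shows "cut s \<delta> (fill_up s \<delta> \<rho> V) = \<rho>"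
proof
  fix i
  have "{j \<in> {1..\<delta> i}. j \<le> part \<mu> i \<or> fill_up s \<delta> \<rho> V (i, j) < s} = {1..\<rho> i}"
    using position_tableauxD(4)[OF V, of i] shapesD(2)[OF \<rho>, of i] st[unfolded strip_def, rule_format, of i]
    by (force simp: fill_up_def in_boxes)
  then show "cut s \<delta> (fill_up s \<delta> \<rho> V) i = \<rho> i" by (simp add: cut_def)
qed

lemma prod_boxes_split:
  assumes \<rho>: "\<rho> \<in> shapes B" and \<delta>: "\<delta> \<in> shapes B" and st: "strip s \<rho> \<delta>"
    and old: "\<And>\<alpha>. \<alpha> \<in> boxes \<rho> \<Longrightarrow> U \<alpha> = V \<alpha>"
    and new: "\<And>\<alpha>. \<alpha> \<in> boxes \<delta> \<Longrightarrow> \<alpha> \<notin> boxes \<rho> \<Longrightarrow> U \<alpha> = s"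
  shows "(\<Prod>\<alpha>\<in>boxes \<delta>. letter_weight (U \<alpha>))
    = letter_weight s ^ (\<Sum>i\<in>{1..n}. \<delta> i - \<rho> i) * (\<Prod>\<alpha>\<in>boxes \<rho>. letter_weight (V \<alpha>))"
proof -
  have "(i, j) \<in> boxes \<delta> - boxes \<rho> \<longleftrightarrow> (i, j) \<in> (SIGMA i:{1..n}. {\<rho> i<..\<delta> i})" for i j
    using shapesD(2)[OF \<rho>, of i] shapesD(1)[OF \<delta>, of i] by (cases "i \<in> {1..n}") (auto simp: in_boxes)
  then have "boxes \<delta> - boxes \<rho> = (SIGMA i:{1..n}. {\<rho> i<..\<delta> i})"
    unfolding set_eq_iff split_paired_All by blast
  then have "card (boxes \<delta> - boxes \<rho>) = (\<Sum>i\<in>{1..n}. \<delta> i - \<rho> i)" by simp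
  moreover have "(\<Prod>\<alpha>\<in>boxes \<delta>. letter_weight (U \<alpha>))
      = (\<Prod>\<alpha>\<in>boxes \<delta> - boxes \<rho>. letter_weight (U \<alpha>)) * (\<Prod>\<alpha>\<in>boxes \<rho>. letter_weight (U \<alpha>))"
    by (rule prod.subset_diff[OF boxes_mono[OF st] finite_boxes[OF \<delta>]])
  ultimately show ?thesis by (simp add: old new)
qed

text \<open>Erasing the entries equal to \<open>s\<close> is a bijection from the tableaux on
  \<delta> to the pairs of a smaller shape and a tableau on it with entries at most
  \<open>s - 1\<close>; the exponent counts the erased boxes.\<close>

lemma tableau_sum_rec:
  assumes \<delta>: "\<delta> \<in> shapes B"
  shows "tableau_sum s \<delta> = (\<Sum>\<rho> | \<rho> \<in> shapes B \<and> strip s \<rho> \<delta>.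
           letter_weight s ^ (\<Sum>i\<in>{1..n}. \<delta> i - \<rho> i) * tableau_sum (s - 1) \<rho>)"
proof -
  let ?R = "{\<rho>. \<rho> \<in> shapes B \<and> strip s \<rho> \<delta>}"
  let ?w = "\<lambda>\<rho>. letter_weight s ^ (\<Sum>i\<in>{1..n}. \<delta> i - \<rho> i)"
  have "tableau_sum s \<delta> = (\<Sum>(\<rho>, V)\<in>(SIGMA \<rho>:?R. position_tableaux (s - 1) \<rho>).
      ?w \<rho> * (\<Prod>\<alpha>\<in>boxes \<rho>. letter_weight (V \<alpha>)))"
    unfolding tableau_sum_def
  proof (rule sum.reindex_bij_witness[where
        j = "\<lambda>U. (cut s \<delta> U, restrict U (boxes (cut s \<delta> U)))" and i = "\<lambda>(\<rho>, V). fill_up s \<delta> \<rho> V"])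
    fix U assume U: "U \<in> position_tableaux s \<delta>"
    note st = strip_cut[OF \<delta> U] and sh = cut_in_shapes[OF \<delta> U]
    show "(cut s \<delta> U, restrict U (boxes (cut s \<delta> U))) \<in> (SIGMA \<rho>:?R. position_tableaux (s - 1) \<rho>)"
      using st sh restrict_cut_tableau[OF \<delta> U] by auto
    have new: "U \<alpha> = s" if "\<alpha> \<in> boxes \<delta>" "\<alpha> \<notin> boxes (cut s \<delta> U)" for \<alpha>
      using that in_boxes_cut[OF \<delta> U] position_tableauxD(4)[OF U] by (cases \<alpha>) fastforce
    show "(case (cut s \<delta> U, restrict U (boxes (cut s \<delta> U))) of (\<rho>, V) \<Rightarrow> fill_up s \<delta> \<rho> V) = U"
      using new position_tableauxD(1)[OF U] boxes_mono[OF st]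
      by (auto simp: fun_eq_iff fill_up_def extensional_def)
    show "(case (cut s \<delta> U, restrict U (boxes (cut s \<delta> U))) of (\<rho>, V) \<Rightarrow>
        ?w \<rho> * (\<Prod>\<alpha>\<in>boxes \<rho>. letter_weight (V \<alpha>))) = (\<Prod>\<alpha>\<in>boxes \<delta>. letter_weight (U \<alpha>))"
      using prod_boxes_split[OF sh \<delta> st, of U "restrict U (boxes (cut s \<delta> U))"] new by simp
  next
    fix \<rho>V assume "\<rho>V \<in> (SIGMA \<rho>:?R. position_tableaux (s - 1) \<rho>)"
    then obtain \<rho> V where \<rho>V: "\<rho>V = (\<rho>, V)" and \<rho>: "\<rho> \<in> shapes B" and st: "strip s \<rho> \<delta>"
      and V: "V \<in> position_tableaux (s - 1) \<rho>" by auto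
    show "(case \<rho>V of (\<rho>, V) \<Rightarrow> fill_up s \<delta> \<rho> V) \<in> position_tableaux s \<delta>"
      using fill_up_tableau[OF \<rho> \<delta> st V] by (simp add: \<rho>V)
    have "restrict (fill_up s \<delta> \<rho> V) (boxes \<rho>) = V"
      using position_tableauxD(1)[OF V] by (auto simp: fun_eq_iff fill_up_def extensional_def)
    then show "(cut s \<delta> (case \<rho>V of (\<rho>, V) \<Rightarrow> fill_up s \<delta> \<rho> V),
        restrict (case \<rho>V of (\<rho>, V) \<Rightarrow> fill_up s \<delta> \<rho> V)
          (boxes (cut s \<delta> (case \<rho>V of (\<rho>, V) \<Rightarrow> fill_up s \<delta> \<rho> V)))) = \<rho>V"
      by (simp add: \<rho>V cut_fill_up[OF \<rho> \<delta> st V])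
  qed
  also have "\<dots> = (\<Sum>\<rho>\<in>?R. ?w \<rho> * tableau_sum (s - 1) \<rho>)"
    by (subst sum.Sigma[symmetric]) (auto simp: tableau_sum_def sum_distrib_left finite_position_tableaux)
  finally show ?thesis .
qed

text \<open>Position - mu_1 precedes \<open>lo i\<close> for every row i in 1..n, so no box can be
  filled and only the empty filling remains.\<close>

lemma tableau_sum_initial:
  assumes \<rho>: "\<rho> \<in> shapes B"
  shows "tableau_sum (- int (part \<mu> 1)) \<rho> = (if \<rho> = part \<mu> then 1 else 0)"
proof -
  have lo: "lo i > - int (part \<mu> 1)" if "i \<in> {1..n}" for i
    using that part_antimono[OF mu, of 1 i] by (auto simp: lo_def)
  show ?thesis
  proof (cases "boxes \<rho> = {}")
    case True
    then have \<rho>_eq: "\<rho> = part \<mu>"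
      using shapesD(2)[OF \<rho>] by (auto simp: boxes_def fun_eq_iff) (metis le_antisym not_less order_refl)
    have "position_tableaux s \<rho> = {\<lambda>_. undefined}" for s
      by (auto simp: position_tableaux_def True)
    with True show ?thesis by (simp add: tableau_sum_def \<rho>_eq)
  next
    case False
    then obtain i j where ij: "(i, j) \<in> boxes \<rho>" by auto
    then have "i \<in> {1..n}" by (auto simp: boxes_Sigma[OF \<rho>])
    with lo ij have "position_tableaux (- int (part \<mu> 1)) \<rho> = {}"
      using position_tableauxD(2,4)[OF _ ij] by fastforce
    moreover have "\<rho> \<noteq> part \<mu>" using ij by (auto simp: in_boxes)
    ultimately show ?thesis by (simp add: tableau_sum_def)
  qed
qed

text \<open>Serves two purposes: bounding the number of new boxes in a row, and converting bounds on
  rows into the bounds on columns required of hook tableaux.\<close>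

lemma position_tableaux_row_growth:
  assumes U: "U \<in> position_tableaux s \<rho>" and i: "d < i" and le: "part \<mu> i + 1 + t \<le> \<rho> i"
  shows "lo i + int t \<le> U (i, part \<mu> i + 1 + t)"
  using le
proof (induction t)
  case 0
  then show ?case using position_tableauxD(2)[OF U, of i "part \<mu> i + 1"] by (simp add: in_boxes)
next
  case (Suc t)
  then have "U (i, part \<mu> i + 1 + t) < U (i, part \<mu> i + 1 + Suc t)"
    using i by (intro position_tableauxD(6)[OF U]) (auto simp: in_boxes)
  with Suc show ?case by simp
qed

text \<open>Strictly increasing entries between \<open>lo i\<close> and \<open>s\<close> leave room
  for at most s - lo i + 1 boxes. Longer rows have coefficient 0, so the expansion at positive
  positions never has to treat them.\<close>

lemma tableau_sum_nonzero_bound: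
  assumes nz: "tableau_sum s \<rho> \<noteq> 0" and i: "d < i" and lt: "part \<mu> i < \<rho> i"
  shows "int (\<rho> i) \<le> int (part \<mu> i) + s - lo i + 1"
proof -
  from nz obtain U where U: "U \<in> position_tableaux s \<rho>"
    unfolding tableau_sum_def by (meson sum.not_neutral_contains_not_neutral)
  from position_tableaux_row_growth[OF U i, of "\<rho> i - part \<mu> i - 1"] position_tableauxD(4)[OF U, of i "\<rho> i"] lt
  show ?thesis by (simp add: in_boxes)
qed

end

section \<open>Expanding the determinant letter by letter\<close>

lemma mps_const_prod: "mps_const (\<Prod>k\<in>K. F k) = (\<Prod>k\<in>K. mps_const (F k))"
  by (induction K rule: infinite_finite_induct) (auto simp: mps_const_mult)

text \<open>Iterates 1 / (1 - c x) = 1 + c x / (1 - c x). The tail keeps the factor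
  \<open>geo c i\<close>, so that it can be recognised as a multiple of another column.\<close>

lemma geo_expand:
  "xvar i ^ p * geo c i
    = (\<Sum>q<m. mps_const c ^ q * xvar i ^ (p + q)) + mps_const c ^ m * (xvar i ^ (p + m) * geo c i)"
proof (induction m)
  case (Suc m)
  have "geo c i = 1 + mps_const c * xvar i * geo c i"
    using geo_inverse[of c i] by (simp add: algebra_simps)
  then have "mps_const c ^ m * (xvar i ^ (p + m) * geo c i)
      = mps_const c ^ m * (xvar i ^ (p + m) * (1 + mps_const c * xvar i * geo c i))"
    by simp
  also have "\<dots> = mps_const c ^ m * xvar i ^ (p + m)
      + mps_const c ^ Suc m * (xvar i ^ (p + Suc m) * geo c i)"
    by (simp add: algebra_simps)
  finally show ?case using Suc by (simp add: add.assoc)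
qed simp

lemma geo_expand_interval:
  assumes "a \<le> b" "j \<le> n"
  shows "xvar i ^ (a + n - j) * geo c i
    = (\<Sum>q\<in>{a..<b}. mps_const c ^ (q - a) * xvar i ^ (q + n - j))
      + mps_const c ^ (b - a) * (xvar i ^ (b + n - j) * geo c i)"
proof -
  have "(\<Sum>q<b - a. mps_const c ^ q * xvar i ^ (a + n - j + q))
      = (\<Sum>q\<in>{a..<b}. mps_const c ^ (q - a) * xvar i ^ (q + n - j))"
    by (rule sum.reindex_bij_witness[where i = "\<lambda>q. q - a" and j = "\<lambda>q. q + a"])
       (use assms in \<open>auto simp: ac_simps\<close>)
  moreover have "a + n - j + (b - a) = b + n - j" using assms by simp
  ultimately show ?thesis using geo_expand[of i "a + n - j" c "b - a"] by simp
qed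

context dual_schur_setup
begin

section \<open>Partially expanded determinants and one step of the expansion\<close>

definition letter_factor :: "int \<Rightarrow> nat \<Rightarrow> Qa mps" where
  "letter_factor s i = (if s \<le> 0 then geo (avar s) i else 1 - mps_const (avar (int n + 1 - s)) * xvar i)"

definition remaining_factors :: "int \<Rightarrow> nat \<Rightarrow> nat \<Rightarrow> Qa mps" where
  "remaining_factors s i j = (\<Prod>s'\<in>{max (s + 1) (lo j)..hi j}. letter_factor s' i)"

text \<open>Interpolates between the two kinds of numerators: for \<rho> = mu and s = - mu_1 it is
  that of the dual Schur polynomial, while at s = n no factors are left and it is an
  alternant.\<close>

definition stage_det :: "int \<Rightarrow> (nat \<Rightarrow> nat) \<Rightarrow> Qa mps" where
  "stage_det s \<rho> = ndet n (\<lambda>i j. xvar i ^ (\<rho> j + n - j) * remaining_factors s i j)"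

definition active :: "int \<Rightarrow> nat \<Rightarrow> bool" where
  "active s j \<longleftrightarrow> lo j \<le> s \<and> s \<le> hi j"

lemma remaining_factors_step:
  "remaining_factors (s - 1) i j
    = (if active s j then letter_factor s i * remaining_factors s i j else remaining_factors s i j)"
proof (cases "active s j")
  case True
  then have "{max (s - 1 + 1) (lo j)..hi j} = insert s {max (s + 1) (lo j)..hi j}"
    by (auto simp: active_def)
  then show ?thesis using True by (simp add: remaining_factors_def)
next
  case False
  then have "{max (s - 1 + 1) (lo j)..hi j} = {max (s + 1) (lo j)..hi j}"
    by (auto simp: active_def)
  then show ?thesis using False by (simp only: remaining_factors_def if_False)
qed

lemma active_nonpos_le_d: "s \<le> 0 \<Longrightarrow> j \<in> {1..n} \<Longrightarrow> active s j \<Longrightarrow> j \<le> d"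
  by (auto simp: active_def lo_def split: if_splits)

lemma active_pos_gt_d: "0 < s \<Longrightarrow> active s j \<Longrightarrow> d < j"
  by (auto simp: active_def hi_def split: if_splits)

text \<open>As j - mu_j increases with j, the active columns form an initial segment; this provides
  the predecessor with the same remaining factors.\<close>

lemma active_nonpos_pred:
  assumes "s \<le> 0" "j \<in> {2..n}" "active s j"
  shows "active s (j - 1)"
proof -
  have "j \<le> d" using active_nonpos_le_d[of s j] assms by auto
  moreover have "part \<mu> j \<le> part \<mu> (j - 1)"
    using assms by (intro part_antimono[OF mu]) auto
  ultimately show ?thesis using assms by (auto simp: active_def lo_def hi_def)
qed

lemma remaining_factors_active_nonpos:
  assumes "s \<le> 0" "j \<in> {1..n}" "active s j"
  shows "remaining_factors s i j = (\<Prod>s'\<in>{s + 1..0}. letter_factor s' i)"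
  using assms active_nonpos_le_d[OF assms]
  by (auto simp: remaining_factors_def active_def hi_def intro!: prod.cong)

lemma stage_det_expand:
  assumes Q: "\<And>j. j \<in> {1..n} \<Longrightarrow> finite (Q j)"
  shows "ndet n (\<lambda>i j. \<Sum>q\<in>Q j. mps_const c ^ (q - \<rho> j) * (xvar i ^ (q + n - j) * remaining_factors s i j))
    = (\<Sum>\<delta> | (\<forall>j\<in>{1..n}. \<delta> j \<in> Q j) \<and> (\<forall>j. j \<notin> {1..n} \<longrightarrow> \<delta> j = 0).
        mps_const (c ^ (\<Sum>j\<in>{1..n}. \<delta> j - \<rho> j)) * stage_det s \<delta>)"
  by (subst ndet_sum_columns[OF Q], simp,
      subst ndet_scale, simp only: stage_det_def mps_const_prod mps_const_power power_sum)

text \<open>For \<open>s \<le> 0\<close>, subtracting from each active column a multiple of its predecessor leaves only the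
  powers of \<open>x\<^sub>i\<close> between the leading powers of the two columns.\<close>

lemma stage_det_step_nonpos:
  assumes s: "s \<le> 0" and \<rho>: "\<rho> \<in> shapes B"
  shows "order_ge B (stage_det (s - 1) \<rho> - (\<Sum>\<delta> | \<delta> \<in> shapes B \<and> strip s \<rho> \<delta>.
      mps_const (letter_weight s ^ (\<Sum>i\<in>{1..n}. \<delta> i - \<rho> i)) * stage_det s \<delta>))"
proof -
  define c where "c = letter_weight s"
  \<comment> \<open>Nothing precedes the first column to end its geometric series, so it is
    truncated at \<open>B\<close>; what is dropped has order at least \<open>B\<close>.\<close>
  define upper where "upper j = (if j = 1 then B else \<rho> (j - 1))" for j :: nat
  define Q where "Q j = (if active s j then {\<rho> j..upper j} else {\<rho> j})" for j
  \<comment> \<open>The coefficient of the tail that starts at exponent upper j + 1 + n - j. For j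
    >= 2 this is \<rho> (j - 1) + n - (j - 1), the leading exponent of the preceding column, so the
    tail is \<open>t j\<close> times that column.\<close>
  define t where "t j = (if active s j then mps_const c ^ (Suc (upper j) - \<rho> j) else 0)" for j
  define f where "f i j = xvar i ^ (\<rho> j + n - j) * remaining_factors (s - 1) i j" for i j
  have upper: "\<rho> j \<le> upper j" if "1 \<le> j" for j
    using that shapesD(3)[OF \<rho>, of j] shapesD(4)[OF \<rho>, of "j - 1" j] by (auto simp: upper_def)
  have f_active: "f i j = (\<Sum>q\<in>Q j. mps_const c ^ (q - \<rho> j) * (xvar i ^ (q + n - j) * remaining_factors s i j))
      + t j * (xvar i ^ (Suc (upper j) + n - j) * geo c i * remaining_factors s i j)"
    if j: "j \<in> {1..n}" "active s j" for i j
  proof -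
    have "f i j = (xvar i ^ (\<rho> j + n - j) * geo c i) * remaining_factors s i j"
      using s j by (simp add: f_def remaining_factors_step letter_factor_def c_def letter_weight_def)
    also have "xvar i ^ (\<rho> j + n - j) * geo c i
        = (\<Sum>q\<in>Q j. mps_const c ^ (q - \<rho> j) * xvar i ^ (q + n - j))
          + t j * (xvar i ^ (Suc (upper j) + n - j) * geo c i)"
      using geo_expand_interval[of "\<rho> j" "Suc (upper j)" j n i c] upper[of j] j
      by (simp add: t_def Q_def atLeastLessThanSuc_atLeastAtMost del: mult_eq_0_iff)
    finally show ?thesis by (simp add: distrib_right sum_distrib_right mult.assoc)
  qed
  have "order_ge B ((if j \<ge> 2 then f i j - t j * f i (j - 1) else f i j)
      - (\<Sum>q\<in>Q j. mps_const c ^ (q - \<rho> j) * (xvar i ^ (q + n - j) * remaining_factors s i j)))"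
    if ij: "i \<in> {1..n}" "j \<in> {1..n}" for i j
  proof (cases "active s j")
    case False
    then show ?thesis by (simp add: t_def Q_def f_def remaining_factors_step)
  next
    case True
    show ?thesis
    proof (cases "j \<ge> 2")
      case ge: True
      then have act: "active s (j - 1)" and j1: "j - 1 \<in> {1..n}"
        using active_nonpos_pred[OF s _ True] ij by auto
      have "\<rho> (j - 1) + n - (j - 1) = Suc (upper j) + n - j"
        using ge ij by (auto simp: upper_def)
      moreover have "remaining_factors s i (j - 1) = remaining_factors s i j"
        by (simp only: remaining_factors_active_nonpos[OF s ij(2) True] remaining_factors_active_nonpos[OF s j1 act])
      ultimately have "f i (j - 1) = xvar i ^ (Suc (upper j) + n - j) * geo c i * remaining_factors s i j"
        using act s by (simp add: f_def remaining_factors_step letter_factor_def c_def letter_weight_def)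
      then show ?thesis using ge f_active[OF ij(2) True, of i] by simp
    next
      case False
      then have "j = 1" using ij by auto
      then have "Suc (upper j) + n - j \<ge> B" by (simp add: upper_def)
      then have "order_ge B (t j * (xvar i ^ (Suc (upper j) + n - j) * geo c i * remaining_factors s i j))"
        by (intro order_ge_mult_left order_ge_mult_right order_ge_mono[OF order_ge_xvar_power])
      then show ?thesis using False f_active[OF ij(2) True, of i] by simp
    qed
  qed
  then have "order_ge B (ndet n (\<lambda>i j. if j \<ge> 2 then f i j - t j * f i (j - 1) else f i j)
      - ndet n (\<lambda>i j. \<Sum>q\<in>Q j. mps_const c ^ (q - \<rho> j) * (xvar i ^ (q + n - j) * remaining_factors s i j)))"
    by (rule order_ge_ndet_diff)
  \<comment> \<open>The choices interlace, \<delta> j <= \<rho> (j - 1) <= \<delta> (j - 1) for j >=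
    2, so each is weakly decreasing already and no terms have to cancel.\<close>
  moreover have "{\<delta>. (\<forall>j\<in>{1..n}. \<delta> j \<in> Q j) \<and> (\<forall>j. j \<notin> {1..n} \<longrightarrow> \<delta> j = 0)}
      = {\<delta>. \<delta> \<in> shapes B \<and> strip s \<rho> \<delta>}" (is "?L = ?R")
  proof (intro equalityI subsetI; elim CollectE; intro CollectI)
    fix \<delta> assume \<delta>: "(\<forall>j\<in>{1..n}. \<delta> j \<in> Q j) \<and> (\<forall>j. j \<notin> {1..n} \<longrightarrow> \<delta> j = 0)"
    have ge: "\<rho> j \<le> \<delta> j" and le: "1 \<le> j \<Longrightarrow> \<delta> j \<le> upper j" and
      act: "\<rho> j < \<delta> j \<Longrightarrow> j \<in> {1..n} \<and> active s j" for j
      using \<delta>[THEN conjunct1, rule_format, of j] \<delta>[THEN conjunct2, rule_format, of j]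
        shapesD(1)[OF \<rho>, of j] upper[of j]
      by (cases "j \<in> {1..n}"; auto simp: Q_def split: if_splits)+
    have act_d: "j \<le> d" if "\<rho> j < \<delta> j" for j
      using active_nonpos_le_d[OF s] act[OF that] by blast
    have upper_B: "upper j \<le> B" for j using shapesD(3)[OF \<rho>] by (simp add: upper_def)
    have "\<delta> j \<le> \<delta> i" if "1 \<le> i" "i \<le> j" for i j
    proof (cases "i = j")
      case False
      then have "\<delta> j \<le> \<rho> (j - 1)" using le[of j] that by (simp add: upper_def)
      also have "\<dots> \<le> \<rho> i" using False that by (intro shapesD(4)[OF \<rho>]) auto
      finally show ?thesis using ge[of i] by simp
    qed simp
    moreover have "part \<mu> i \<le> \<delta> i" for i
      using ge[of i] shapesD(2)[OF \<rho>, of i] by simp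
    moreover have "\<delta> i \<le> B" for i
      using le[of i] upper_B[of i] \<delta> by (cases "i \<in> {1..n}") auto
    moreover have "\<delta> i \<le> d" if "d < i" for i
      using act_d[of i] that shapesD(5)[OF \<rho> that] by linarith
    moreover have "strip s \<rho> \<delta>"
      unfolding strip_def
    proof (intro allI conjI impI)
      fix i
      show "\<rho> i \<le> \<delta> i" by (rule ge)
      assume lt: "\<rho> i < \<delta> i"
      show "lo i \<le> s" "s \<le> hi i" using act[OF lt] by (auto simp: active_def)
      show "\<delta> i \<le> \<rho> (i - 1)" if "i \<le> d \<and> 2 \<le> i" using le[of i] that by (simp add: upper_def)
      show "\<delta> i \<le> \<rho> i + 1" if "d < i" using act_d[OF lt] that by simp
    qed
    ultimately show "\<delta> \<in> shapes B \<and> strip s \<rho> \<delta>"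
      using \<delta> by (simp add: shapes_def)
  next
    fix \<delta> assume \<delta>: "\<delta> \<in> shapes B \<and> strip s \<rho> \<delta>"
    have "\<delta> j \<in> Q j" if j: "j \<in> {1..n}" for j
    proof (cases "\<rho> j < \<delta> j")
      case True
      then have act: "active s j" and le: "j \<le> d \<and> 2 \<le> j \<longrightarrow> \<delta> j \<le> \<rho> (j - 1)"
        using \<delta> by (auto simp: strip_def active_def)
      with active_nonpos_le_d[OF s j act] shapesD(3)[of \<delta> B j] True \<delta> j show ?thesis
        by (auto simp: Q_def upper_def)
    next
      case False
      then have "\<delta> j = \<rho> j" using \<delta> by (simp add: strip_def le_antisym)
      then show ?thesis using upper[of j] j by (auto simp: Q_def)
    qed
    then show "(\<forall>j\<in>{1..n}. \<delta> j \<in> Q j) \<and> (\<forall>j. j \<notin> {1..n} \<longrightarrow> \<delta> j = 0)"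
      using \<delta> shapesD(1)[of \<delta> B] by blast
  qed
  moreover have "ndet n (\<lambda>i j. \<Sum>q\<in>Q j. mps_const c ^ (q - \<rho> j) * (xvar i ^ (q + n - j) * remaining_factors s i j))
      = (\<Sum>\<delta>\<in>?L. mps_const (c ^ (\<Sum>j\<in>{1..n}. \<delta> j - \<rho> j)) * stage_det s \<delta>)"
    by (rule stage_det_expand) (simp add: Q_def)
  moreover have "ndet n f = stage_det (s - 1) \<rho>"
    unfolding stage_det_def by (rule ndet_cong) (rule f_def)
  ultimately show ?thesis
    by (simp only: ndet_column_ops c_def)
qed

text \<open>For \<open>s > 0\<close>, a term of the expansion that does not belong to a partition has two equal columns.\<close>

lemma stage_det_step_pos:
  assumes s: "0 < s" "s \<le> int n" and \<rho>: "\<rho> \<in> shapes B"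
    and bound: "\<And>i. d < i \<Longrightarrow> part \<mu> i < \<rho> i \<Longrightarrow> int (\<rho> i) \<le> int (part \<mu> i) + s - lo i"
  shows "stage_det (s - 1) \<rho> = (\<Sum>\<delta> | \<delta> \<in> shapes B \<and> strip s \<rho> \<delta>.
      mps_const (letter_weight s ^ (\<Sum>i\<in>{1..n}. \<delta> i - \<rho> i)) * stage_det s \<delta>)"
proof -
  define c where "c = letter_weight s"
  define Q where "Q j = (if active s j then {\<rho> j, Suc (\<rho> j)} else {\<rho> j})" for j
  have entry: "xvar i ^ (\<rho> j + n - j) * remaining_factors (s - 1) i j
      = (\<Sum>q\<in>Q j. mps_const c ^ (q - \<rho> j) * (xvar i ^ (q + n - j) * remaining_factors s i j))"
    if j: "j \<in> {1..n}" for i j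
  proof (cases "active s j")
    case True
    have "letter_factor s i = 1 + mps_const c * xvar i"
      using s by (simp add: letter_factor_def c_def letter_weight_def mps_const_uminus)
    moreover have "Suc (\<rho> j) + n - j = Suc (\<rho> j + n - j)" using j by auto
    ultimately show ?thesis
      using True by (simp add: remaining_factors_step Q_def algebra_simps)
  qed (simp add: remaining_factors_step Q_def)
  let ?L = "{\<delta>. (\<forall>j\<in>{1..n}. \<delta> j \<in> Q j) \<and> (\<forall>j. j \<notin> {1..n} \<longrightarrow> \<delta> j = 0)}"
  let ?R = "{\<delta>. \<delta> \<in> shapes B \<and> strip s \<rho> \<delta>}"
  let ?T = "\<lambda>\<delta>. mps_const (c ^ (\<Sum>j\<in>{1..n}. \<delta> j - \<rho> j)) * stage_det s \<delta>"
  have "stage_det (s - 1) \<rho> = ndet n (\<lambda>i j. \<Sum>q\<in>Q j. mps_const c ^ (q - \<rho> j) * (xvar i ^ (q + n - j) * remaining_factors s i j))"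
    unfolding stage_det_def by (rule ndet_cong) (rule entry)
  also have "\<dots> = (\<Sum>\<delta>\<in>?L. ?T \<delta>)"
    by (rule stage_det_expand) (simp add: Q_def)
  also have "\<dots> = (\<Sum>\<delta>\<in>?R. ?T \<delta>)"
  proof (rule sum.mono_neutral_right)
    have "?L \<subseteq> (\<lambda>g i. if i \<in> {1..n} then g i else 0) ` (PiE {1..n} Q)"
    proof
      fix \<delta> assume "\<delta> \<in> ?L"
      then have "\<delta> = (\<lambda>i. if i \<in> {1..n} then restrict \<delta> {1..n} i else 0)" "restrict \<delta> {1..n} \<in> PiE {1..n} Q"
        by (auto simp: fun_eq_iff)
      then show "\<delta> \<in> (\<lambda>g i. if i \<in> {1..n} then g i else 0) ` (PiE {1..n} Q)"
        by (rule image_eqI)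
    qed
    then show "finite ?L"
      by (rule finite_subset) (intro finite_imageI finite_PiE; simp add: Q_def)
  next
    show "?R \<subseteq> ?L"
    proof safe
      fix \<delta> j assume \<delta>: "\<delta> \<in> shapes B" "strip s \<rho> \<delta>"
      show "\<delta> j = 0" if "j \<notin> {1..n}" using shapesD(1)[OF \<delta>(1) that] .
      have st: "\<rho> j \<le> \<delta> j" "\<rho> j < \<delta> j \<Longrightarrow> active s j \<and> (d < j \<longrightarrow> \<delta> j \<le> \<rho> j + 1)"
        using \<delta>(2) by (auto simp: strip_def active_def)
      then show "\<delta> j \<in> Q j"
        using active_pos_gt_d[OF s(1), of j] by (cases "\<rho> j < \<delta> j") (auto simp: Q_def)
    qed
  next
    \<comment> \<open>Inserting \<open>lo j\<close> into \<open>bound\<close> eliminates mu_j; a row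
      still equal to that of mu gets the same estimate from being active. Since s <= n, this yields
      \<rho> j <= j - 2.\<close>
    have small: "int (\<rho> j) \<le> int j + s - int n - 2" if "active s j" for j
      using active_pos_gt_d[OF s(1) that] that bound[of j] shapesD(2)[OF \<rho>, of j]
      by (cases "part \<mu> j < \<rho> j") (auto simp: active_def lo_def)
    have d_B: "d \<le> B"
      using part_ge_d[of 1] shapesD(2,3)[OF \<rho>, of 1] by (cases "d = 0") auto
    show "\<forall>\<delta>\<in>?L - ?R. ?T \<delta> = 0"
    proof
      fix \<delta> assume "\<delta> \<in> ?L - ?R"
      then have \<delta>: "\<And>j. j \<in> {1..n} \<Longrightarrow> \<delta> j \<in> Q j" "\<And>j. j \<notin> {1..n} \<Longrightarrow> \<delta> j = 0"
        and not: "\<not> (\<delta> \<in> shapes B \<and> strip s \<rho> \<delta>)" by auto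
      have ge: "\<rho> j \<le> \<delta> j" and le: "\<delta> j \<le> Suc (\<rho> j)" and
        act: "\<rho> j < \<delta> j \<Longrightarrow> j \<in> {1..n} \<and> active s j" for j
        using \<delta>(1)[of j] \<delta>(2)[of j] shapesD(1)[OF \<rho>, of j]
        by (cases "j \<in> {1..n}"; auto simp: Q_def split: if_splits)+
      have strip: "strip s \<rho> \<delta>"
        using ge le act active_pos_gt_d[OF s(1)] by (fastforce simp: strip_def active_def)
      have "\<exists>j\<in>{2..n}. \<delta> (j - 1) < \<delta> j"
      proof (rule ccontr)
        assume "\<not> (\<exists>j\<in>{2..n}. \<delta> (j - 1) < \<delta> j)"
        then have no: "\<forall>j\<in>{2..n}. \<delta> j \<le> \<delta> (j - 1)" by (simp add: not_less)
        have desc: "\<delta> (Suc j) \<le> \<delta> j" if "1 \<le> j" for j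
          using that \<delta>(2)[of "Suc j"] no[rule_format, of "Suc j"] by (cases "Suc j \<le> n") auto
        have anti: "\<delta> j \<le> \<delta> i" if "1 \<le> i" "i \<le> j" for i j
          using that(2) by (induction j rule: dec_induct) (use that(1) in \<open>auto intro: order_trans[OF desc]\<close>)
        \<comment> \<open>If row d + 1 grows, it had at most d - 1 boxes by \<open>small\<close>, so
          the new box does not lengthen the diagonal.\<close>
        have "\<delta> (Suc d) \<le> d"
          using act[of "Suc d"] small[of "Suc d"] le[of "Suc d"] ge[of "Suc d"] shapesD(5)[OF \<rho>, of "Suc d"] s
          by (cases "\<rho> (Suc d) < \<delta> (Suc d)") auto
        then have le_d: "\<delta> i \<le> d" if "d < i" for i
          using anti[of "Suc d" i] that by simp
        have "\<delta> i \<le> B" for i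
        proof (cases "\<rho> i < \<delta> i")
          case True
          then have "d < i" using act[OF True] active_pos_gt_d[OF s(1)] by blast
          then show ?thesis using le_d[of i] d_B by simp
        next
          case False
          then show ?thesis using shapesD(3)[OF \<rho>, of i] by simp
        qed
        moreover have "part \<mu> i \<le> \<delta> i" for i
          using ge[of i] shapesD(2)[OF \<rho>, of i] by simp
        ultimately have "\<delta> \<in> shapes B"
          using anti le_d \<delta>(2) by (simp add: shapes_def)
        with not strip show False by blast
      qed
      then obtain j where j: "j \<in> {2..n}" and "\<delta> (j - 1) < \<delta> j" by blast
      moreover have "\<rho> j \<le> \<rho> (j - 1)" using j by (intro shapesD(4)[OF \<rho>]) auto
      ultimately have eq: "\<delta> j = Suc (\<rho> j)" "\<delta> (j - 1) = \<rho> j" "\<rho> (j - 1) = \<rho> j"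
        using ge[of "j - 1"] le[of j] by auto
      have actj: "active s j" using act[of j] eq by simp
      have dj: "d < j" by (rule active_pos_gt_d[OF s(1) actj])
      \<comment> \<open>If j - 1 = d, then row d, of length at least d, would be as long as row d +
        1, to which \<open>small\<close> allows at most d - 1 boxes.\<close>
      have pred: "d < j - 1"
      proof (rule ccontr)
        assume "\<not> d < j - 1"
        then have "d = j - 1" using dj by simp
        moreover have "1 \<le> j - 1" using j by auto
        ultimately have "d \<le> \<rho> j"
          using part_ge_d[of "j - 1"] shapesD(2)[OF \<rho>, of "j - 1"] eq(3) by auto
        then show False using small[OF actj] s \<open>d = j - 1\<close> j by simp
      qed
      \<comment> \<open>Column j - 1 need not contain the current letter, only all later ones. If it
        is inactive, row j - 1 is still that of mu, and its length is that of row j, which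
        \<open>small\<close> bounds.\<close>
      have lo_pred: "lo (j - 1) \<le> s + 1"
      proof (cases "active s (j - 1)")
        case False
        then have "part \<mu> (j - 1) = \<rho> (j - 1)"
          using bound[OF pred] shapesD(2)[OF \<rho>, of "j - 1"] pred s
          by (cases "part \<mu> (j - 1) < \<rho> (j - 1)") (auto simp: active_def hi_def)
        then show ?thesis using small[OF actj] pred eq(3) j by (simp add: lo_def)
      qed (simp add: active_def)
      have same: "remaining_factors s i j = remaining_factors s i (j - 1)" for i
        using lo_pred actj pred dj
        by (auto simp: remaining_factors_def active_def hi_def max_def intro!: prod.cong)
      have exps: "\<delta> j + n - j = \<delta> (j - 1) + n - (j - 1)"
        using eq j by auto
      have "stage_det s \<delta> = 0"
        unfolding stage_det_def
        by (rule ndet_identical_columns[of j _ "j - 1"]) (use j in \<open>auto simp: same exps\<close>)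
      then show "?T \<delta> = 0" by simp
    qed
  qed
  finally show ?thesis by (simp add: c_def)
qed

section \<open>From the numerator of the dual Schur polynomial to alternants\<close>

lemma part_in_shapes:
  assumes "part \<mu> 1 \<le> B"
  shows "part \<mu> \<in> shapes B"
proof -
  have "part \<mu> i \<le> B" for i
    using part_antimono[OF mu, of 1 i] assms by (cases "i = 0") auto
  moreover have "part \<mu> i \<le> d" if "d < i" for i
  proof -
    have "part \<mu> i \<le> part \<mu> (Suc d)" using that by (intro part_antimono[OF mu]) auto
    with part_lt[of "Suc d"] show ?thesis by simp
  qed
  moreover have "part \<mu> i = 0" if "i \<notin> {1..n}" for i
    using that len by (cases "i = 0") (auto intro: part_eq_0)
  ultimately show ?thesis using part_antimono[OF mu] by (simp add: shapes_def)
qed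

text \<open>Induction on the position: each shape is replaced by its extensions by a strip, and
  after exchanging the two sums the coefficients of each new shape combine by
  \<open>tableau_sum_rec\<close>.\<close>

lemma stage_det_expansion:
  assumes B: "part \<mu> 1 \<le> B" and s: "- int (part \<mu> 1) \<le> s" "s \<le> int n"
  shows "order_ge B (stage_det (- int (part \<mu> 1)) (part \<mu>)
           - (\<Sum>\<rho>\<in>shapes B. mps_const (tableau_sum s \<rho>) * stage_det s \<rho>))"
  using s
proof (induction s rule: int_ge_induct)
  case base
  have "(\<Sum>\<rho>\<in>shapes B. mps_const (tableau_sum (- int (part \<mu> 1)) \<rho>) * stage_det (- int (part \<mu> 1)) \<rho>)
      = (\<Sum>\<rho>\<in>shapes B. if \<rho> = part \<mu> then stage_det (- int (part \<mu> 1)) \<rho> else 0)"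
    by (intro sum.cong refl) (simp add: tableau_sum_initial del: One_nat_def)
  also have "\<dots> = stage_det (- int (part \<mu> 1)) (part \<mu>)"
    using part_in_shapes[OF B] by simp
  finally show ?case by simp
next
  case (step s)
  define t where "t = s + 1"
  then have ts: "t - 1 = s" and t: "t \<le> int n" using step.prems by auto
  let ?D = "stage_det (- int (part \<mu> 1)) (part \<mu>)"
  let ?E = "\<lambda>\<rho>. \<Sum>\<delta> | \<delta> \<in> shapes B \<and> strip t \<rho> \<delta>.
      mps_const (letter_weight t ^ (\<Sum>i\<in>{1..n}. \<delta> i - \<rho> i)) * stage_det t \<delta>"
  have "order_ge B (mps_const (tableau_sum s \<rho>) * stage_det s \<rho> - mps_const (tableau_sum s \<rho>) * ?E \<rho>)"
    if \<rho>: "\<rho> \<in> shapes B" for \<rho>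
  \<comment> \<open>A vanishing coefficient makes both sides 0; a nonzero one provides the bound
    that the step at a positive position requires.\<close>
  proof (cases "t \<le> 0 \<or> tableau_sum s \<rho> = 0")
    case True
    then show ?thesis
      using stage_det_step_nonpos[OF _ \<rho>, of t]
      by (auto simp: ts simp flip: right_diff_distrib intro: order_ge_mult_left)
  next
    case False
    have "stage_det (t - 1) \<rho> = ?E \<rho>"
    proof (rule stage_det_step_pos[OF _ t \<rho>])
      show "0 < t" using False by simp
      show "int (\<rho> i) \<le> int (part \<mu> i) + t - lo i" if "d < i" "part \<mu> i < \<rho> i" for i
        using tableau_sum_nonzero_bound[of s \<rho> i] that False by (simp add: t_def)
    qed
    then show ?thesis by (simp add: ts)
  qed
  then have "order_ge B ((\<Sum>\<rho>\<in>shapes B. mps_const (tableau_sum s \<rho>) * stage_det s \<rho>)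
      - (\<Sum>\<rho>\<in>shapes B. mps_const (tableau_sum s \<rho>) * ?E \<rho>))"
    unfolding sum_subtractf[symmetric] by (rule order_ge_sum)
  then have "order_ge B (?D - (\<Sum>\<rho>\<in>shapes B. mps_const (tableau_sum s \<rho>) * ?E \<rho>))"
    using order_ge_add[OF step.IH] step.prems by fastforce
  also have "(\<Sum>\<rho>\<in>shapes B. mps_const (tableau_sum s \<rho>) * ?E \<rho>)
      = (\<Sum>\<rho>\<in>shapes B. \<Sum>\<delta> | \<delta> \<in> shapes B \<and> strip t \<rho> \<delta>.
          mps_const (letter_weight t ^ (\<Sum>i\<in>{1..n}. \<delta> i - \<rho> i) * tableau_sum s \<rho>) * stage_det t \<delta>)"
    by (simp add: sum_distrib_left mps_const_mult mult_ac)
  also have "\<dots> = (\<Sum>\<delta>\<in>shapes B. \<Sum>\<rho> | \<rho> \<in> shapes B \<and> strip t \<rho> \<delta>.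
          mps_const (letter_weight t ^ (\<Sum>i\<in>{1..n}. \<delta> i - \<rho> i) * tableau_sum s \<rho>) * stage_det t \<delta>)"
    by (rule sum.swap_restrict) simp_all
  also have "\<dots> = (\<Sum>\<delta>\<in>shapes B. mps_const (tableau_sum t \<delta>) * stage_det t \<delta>)"
    by (intro sum.cong refl) (simp add: tableau_sum_rec[of _ B t] ts mps_const_sum sum_distrib_right)
  finally show ?case by (simp add: t_def)
qed

lemma stage_det_final: "stage_det (int n) \<rho> = ndet n (\<lambda>i j. xvar i ^ (\<rho> j + n - j))"
  by (simp add: stage_det_def remaining_factors_def hi_def)

lemma dual_schur_entry_eq:
  assumes j: "j \<in> {1..n}"
  shows "dual_schur_entry n \<mu> i j
    = xvar i ^ (part \<mu> j + n - j) * remaining_factors (- int (part \<mu> 1)) i j"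
proof -
  have "part \<mu> j \<le> part \<mu> 1" using j by (intro part_antimono[OF mu]) auto
  then have lo: "- int (part \<mu> 1) + 1 \<le> lo j" using j by (auto simp: lo_def)
  show ?thesis
  proof (cases "j \<le> d")
    case True
    have "(\<Prod>k\<in>{int j - int (part \<mu> j)..0}. 1 - mps_const (avar k) * xvar i) * remaining_factors (- int (part \<mu> 1)) i j
        = (\<Prod>k\<in>{int j - int (part \<mu> j)..0}. (1 - mps_const (avar k) * xvar i) * geo (avar k) i)"
      using True lo by (simp add: remaining_factors_def max_absorb2 lo_def hi_def letter_factor_def prod.distrib)
    also have "\<dots> = 1" by (simp add: geo_inverse)
    finally show ?thesis
      using True by (simp add: dual_schur_entry_def mps_quot_unit)
  next
    case False
    then have "remaining_factors (- int (part \<mu> 1)) i j = (\<Prod>s\<in>{lo j..int n}. letter_factor s i)"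
      using lo by (simp add: remaining_factors_def hi_def max_absorb2)
    also have "\<dots> = (\<Prod>k\<in>{1..int j - int (part \<mu> j) - 1}. 1 - mps_const (avar k) * xvar i)"
      by (rule prod.reindex_bij_witness[where i = "\<lambda>k. int n + 1 - k" and j = "\<lambda>k. int n + 1 - k"])
         (use False j in \<open>auto simp: lo_def letter_factor_def\<close>)
    finally show ?thesis
      using False by (simp add: dual_schur_entry_def)
  qed
qed

lemma dual_schur_det_expansion:
  assumes B: "part \<mu> 1 \<le> B"
  shows "order_ge B (ndet n (dual_schur_entry n \<mu>)
           - (\<Sum>\<rho>\<in>shapes B. mps_const (tableau_sum (int n) \<rho>) * ndet n (\<lambda>i j. xvar i ^ (\<rho> j + n - j))))"
proof -
  have "ndet n (dual_schur_entry n \<mu>) = stage_det (- int (part \<mu> 1)) (part \<mu>)"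
    unfolding stage_det_def by (rule ndet_cong) (rule dual_schur_entry_eq)
  then show ?thesis
    using stage_det_expansion[OF B, of "int n"] by (simp add: stage_det_final)
qed

end

section \<open>Hook tableaux and the expansion\<close>

lemma conj_part_iff:
  assumes "is_partition \<mu>" "1 \<le> i" "1 \<le> j"
  shows "i \<le> conj_part \<mu> j \<longleftrightarrow> j \<le> part \<mu> i"
proof -
  let ?S = "{i. (i, j) \<in> diagram \<mu>}"
  have "i \<in> {1..length \<mu>}" if "i \<in> ?S" for i
    using that assms(3) part_eq_0[of \<mu> i] by (cases "i \<le> length \<mu>") (auto simp: diagram_def)
  then have "finite ?S" by (meson finite_atLeastAtMost finite_subset subsetI)
  moreover have "i \<in> ?S" if "k \<in> ?S" "1 \<le> i" "i \<le> k" for i k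
    using that part_antimono[OF assms(1), of i k] by (auto simp: diagram_def)
  ultimately have "?S = {1..conj_part \<mu> j}"
    unfolding conj_part_def by (intro downclosed_eq_atLeastAtMost) (auto simp: diagram_def)
  then have "i \<in> ?S \<longleftrightarrow> i \<in> {1..conj_part \<mu> j}" by (rule arg_cong)
  with assms show ?thesis by (auto simp: diagram_def)
qed

lemma part_le_if_diagram_subset:
  assumes "diagram \<mu> \<subseteq> diagram \<nu>"
  shows "part \<mu> i \<le> part \<nu> i"
proof (cases "i = 0 \<or> part \<mu> i = 0")
  case False
  then have "(i, part \<mu> i) \<in> diagram \<mu>" by (simp add: diagram_def)
  with assms show ?thesis by (auto simp: diagram_def)
qed auto

lemma length_le_if_diagram_subset:
  assumes "is_partition \<mu>" "diagram \<mu> \<subseteq> diagram \<nu>"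
  shows "length \<mu> \<le> length \<nu>"
proof (cases "length \<mu> = 0")
  case False
  then have "0 < part \<mu> (length \<mu>)" by (intro part_pos[OF assms(1)]) (auto simp: Suc_le_eq)
  then have "part \<nu> (length \<mu>) \<noteq> 0"
    using part_le_if_diagram_subset[OF assms(2), of "length \<mu>"] by simp
  then show ?thesis using part_eq_0[of \<nu> "length \<mu>"] by (meson not_le)
qed simp

lemma part_inj:
  assumes "is_partition \<mu>" "is_partition \<nu>" "part \<mu> = part \<nu>"
  shows "\<mu> = \<nu>"
proof (rule nth_equalityI)
  show "length \<mu> = length \<nu>"
    using assms by (intro antisym length_le_if_diagram_subset) (auto simp: diagram_def)
  show "\<mu> ! i = \<nu> ! i" if "i < length \<mu>" for i
    using that fun_cong[OF assms(3), of "Suc i"] \<open>length \<mu> = length \<nu>\<close> by (simp add: part_def)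
qed

lemma exists_partition:
  assumes "\<And>i. i \<notin> {1..n} \<Longrightarrow> \<rho> i = 0" and anti: "\<And>i j. 1 \<le> i \<Longrightarrow> i \<le> j \<Longrightarrow> \<rho> j \<le> \<rho> i"
  shows "\<exists>\<nu>. is_partition \<nu> \<and> length \<nu> \<le> n \<and> part \<nu> = \<rho>"
proof -
  let ?S = "{i. 0 < \<rho> i}"
  have S: "?S \<subseteq> {1..n}" using assms(1) by fastforce
  define m where "m = card ?S"
  have m: "?S = {1..m}"
    unfolding m_def
  proof (rule downclosed_eq_atLeastAtMost)
    show "finite ?S" using S by (rule finite_subset) simp
    show "0 \<notin> ?S" using S by auto
    show "i \<in> ?S" if "j \<in> ?S" "1 \<le> i" "i \<le> j" for i j
      using that anti[of i j] by auto
  qed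
  have pos: "0 < \<rho> i \<longleftrightarrow> i \<in> {1..m}" for i
    using arg_cong[OF m, of "\<lambda>S. i \<in> S"] by simp
  let ?\<nu> = "map \<rho> [1..<Suc m]"
  have "sorted_wrt (\<ge>) ?\<nu>"
    unfolding sorted_wrt_iff_nth_less by (auto intro!: anti simp del: upt_Suc)
  moreover have "0 \<notin> set ?\<nu>"
  proof
    assume "0 \<in> set ?\<nu>"
    then obtain i where "i \<in> {1..m}" "\<rho> i = 0" by (force simp del: upt_Suc)
    with pos[of i] show False by simp
  qed
  ultimately have "is_partition ?\<nu>" by (simp add: is_partition_def)
  moreover have "length ?\<nu> \<le> n" using S card_mono[of "{1..n}" ?S] by (simp add: m_def)
  moreover have "part ?\<nu> i = \<rho> i" for i
    using pos[of i] by (cases "i \<in> {1..m}") (auto simp: part_def simp del: upt_Suc)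
  ultimately show ?thesis by blast
qed

context dual_schur_setup
begin

definition expansion_partitions :: "nat \<Rightarrow> nat list set" where
  "expansion_partitions B = {\<nu>. is_partition \<nu> \<and> diagram \<mu> \<subseteq> diagram \<nu> \<and> diag_len \<nu> = d \<and>
     length \<nu> \<le> n \<and> part \<nu> 1 \<le> B}"

lemma part_in_shapes_if:
  assumes \<nu>: "\<nu> \<in> expansion_partitions B"
  shows "part \<nu> \<in> shapes B"
proof -
  have part: "is_partition \<nu>" and sub: "diagram \<mu> \<subseteq> diagram \<nu>" and diag: "diag_len \<nu> = d"
    and len: "length \<nu> \<le> n" and B: "part \<nu> 1 \<le> B"
    using \<nu> by (auto simp: expansion_partitions_def)
  interpret \<nu>: dual_schur_setup \<nu> n by unfold_locales fact+
  show ?thesis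
    using \<nu>.part_in_shapes[OF B] part_le_if_diagram_subset[OF sub]
    by (simp add: shapes_def \<nu>.shapes_def diag)
qed

lemma bij_betw_part: "bij_betw part (expansion_partitions B) (shapes B)"
proof (rule bij_betw_imageI)
  show "inj_on part (expansion_partitions B)"
    by (rule inj_onI) (auto simp: expansion_partitions_def intro: part_inj)
  show "part ` expansion_partitions B = shapes B"
  proof (intro equalityI subsetI)
    fix \<rho> assume \<rho>: "\<rho> \<in> shapes B"
    obtain \<nu> where \<nu>: "is_partition \<nu>" "length \<nu> \<le> n" "part \<nu> = \<rho>"
      using exists_partition[of n \<rho>] shapesD(1,4)[OF \<rho>] by blast
    have sub: "diagram \<mu> \<subseteq> diagram \<nu>"
      using shapesD(2)[OF \<rho>] by (auto simp: diagram_def \<nu> intro: order_trans)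
    have "i \<le> diag_len \<nu> \<longleftrightarrow> i \<le> d" if "1 \<le> i" for i
      using diag_len_iff[OF \<nu>(1) that] diag_len_iff[OF mu that] shapesD(2)[OF \<rho>, of i] shapesD(5)[OF \<rho>, of i]
      by (auto simp: \<nu>(3) not_le[symmetric] dest: order_trans)
    from this[of d] this[of "diag_len \<nu>"] have "diag_len \<nu> = d"
      by (cases "d = 0"; cases "diag_len \<nu> = 0") auto
    with \<nu> sub shapesD(3)[OF \<rho>, of 1] have "\<nu> \<in> expansion_partitions B"
      by (simp add: expansion_partitions_def)
    then show "\<rho> \<in> part ` expansion_partitions B" using \<nu>(3) by blast
  qed (use part_in_shapes_if in auto)
qed

text \<open>Exchanges letter indices and positions; an involution on the nonpositive integers and on
  1..n, so it serves in both directions.\<close>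

definition flip :: "int \<Rightarrow> int" where
  "flip k = (if k \<le> 0 then k else int n + 1 - k)"

lemma skew_eq_boxes: "skew \<nu> \<mu> = boxes (part \<nu>)"
proof -
  have "(i, j) \<in> skew \<nu> \<mu> \<longleftrightarrow> (i, j) \<in> boxes (part \<nu>)" for i j
    by (cases "i = 0") (auto simp: skew_def diagram_def in_boxes)
  then show ?thesis by auto
qed

lemma conj_part_ge_d: "1 \<le> j \<Longrightarrow> j \<le> d \<Longrightarrow> d \<le> conj_part \<mu> j"
  using part_ge_d[of d] conj_part_iff[OF mu, of d j] by auto

text \<open>Below row \<open>d\<close>, hook tableaux bound the letters by column, mu'_j - j + 1,
  and position tableaux by row, i - mu_i - 1. A row has its largest letter in its first new box,
  where the column bound implies the row bound. A column has its largest letter in its topmost new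
  box, where the row bound and strictness along the row imply the column bound.\<close>

lemma hook_tableaux_reindex:
  assumes \<nu>: "\<nu> \<in> expansion_partitions B"
  shows "tableau_sum (int n) (part \<nu>)
    = (\<Sum>T\<in>hook_tableaux \<nu> \<mu>. \<Prod>\<alpha>\<in>skew \<nu> \<mu>. letter_weight (flip (T \<alpha>)))"
proof -
  let ?S = "boxes (part \<nu>)"
  let ?flip = "\<lambda>T. restrict (\<lambda>\<alpha>. flip (T \<alpha>)) ?S"
  note sh = part_in_shapes_if[OF \<nu>]
  have row: "1 \<le> i" "i \<le> n" if "(i, j) \<in> ?S" for i j
    using that boxes_Sigma[OF sh] by auto
  have upper: "d < j" if "(i, j) \<in> ?S" "i \<le> d" for i j
    using that part_ge_d[of i] row[of i j] by (auto simp: in_boxes)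
  have lower: "1 \<le> j \<and> j \<le> d" if "(i, j) \<in> ?S" "d < i" for i j
    using that shapesD(5)[OF sh, of i] by (auto simp: in_boxes)
  have row_seg: "(i, l) \<in> ?S" if "(i, j) \<in> ?S" "part \<mu> i < l" "l \<le> j" for i j l
    using that by (auto simp: in_boxes)
  have pos: "?flip T \<in> position_tableaux (int n) (part \<nu>) \<and> ?flip (?flip T) = T"
    if T: "T \<in> hook_tableaux \<nu> \<mu>" for T
  proof -
    have TD: "T \<in> extensional ?S"
      "\<And>i j. (i, j) \<in> ?S \<Longrightarrow> i \<le> d \<Longrightarrow> int i - int (part \<mu> i) \<le> T (i, j) \<and> T (i, j) \<le> 0"
      "\<And>i j l. (i, j) \<in> ?S \<Longrightarrow> (i, l) \<in> ?S \<Longrightarrow> i \<le> d \<Longrightarrow> j < l \<Longrightarrow> T (i, j) \<le> T (i, l)"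
      "\<And>i k j. (i, j) \<in> ?S \<Longrightarrow> (k, j) \<in> ?S \<Longrightarrow> i < k \<Longrightarrow> k \<le> d \<Longrightarrow> T (i, j) < T (k, j)"
      "\<And>i j. (i, j) \<in> ?S \<Longrightarrow> j \<le> d \<Longrightarrow> 1 \<le> T (i, j) \<and> T (i, j) \<le> int (conj_part \<mu> j) - int j + 1"
      "\<And>i k j. (i, j) \<in> ?S \<Longrightarrow> (k, j) \<in> ?S \<Longrightarrow> j \<le> d \<Longrightarrow> i < k \<Longrightarrow> T (k, j) \<le> T (i, j)"
      "\<And>i j l. (i, j) \<in> ?S \<Longrightarrow> (i, l) \<in> ?S \<Longrightarrow> j < l \<Longrightarrow> l \<le> d \<Longrightarrow> T (i, l) < T (i, j)"
      using T unfolding hook_tableaux_def Let_def skew_eq_boxes by auto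
    have low_range: "1 \<le> T (i, j) \<and> T (i, j) \<le> int i - 1 - int (part \<mu> i)" if ij: "(i, j) \<in> ?S" "d < i" for i j
    proof -
      let ?l = "part \<mu> i + 1"
      have il: "(i, ?l) \<in> ?S" using ij(1) by (auto simp: in_boxes)
      have "conj_part \<mu> ?l < i"
        using conj_part_iff[OF mu row(1)[OF ij(1)], of ?l] by auto
      moreover have "T (i, j) \<le> T (i, ?l)"
        using TD(7)[OF il ij(1)] lower[OF ij] ij(1) by (cases "j = ?l") (auto simp: in_boxes)
      ultimately show ?thesis using TD(5)[OF il] TD(5)[OF ij(1)] lower[OF il ij(2)] lower[OF ij] by auto
    qed
    have fl: "flip (T (i, j)) = (if i \<le> d then T (i, j) else int n + 1 - T (i, j))" if "(i, j) \<in> ?S" for i j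
      using TD(2)[OF that] low_range[OF that] by (cases "d < i") (auto simp: flip_def)
    have ff: "flip (flip (T \<alpha>)) = T \<alpha>" if "\<alpha> \<in> ?S" for \<alpha>
    proof -
      obtain i j where \<alpha>: "\<alpha> = (i, j)" by (cases \<alpha>)
      show ?thesis
        using that fl[of i j] TD(2)[of i j] low_range[of i j] row[of i j] by (auto simp: \<alpha> flip_def)
    qed
    have "?flip T \<in> position_tableaux (int n) (part \<nu>)"
      unfolding position_tableaux_def
    proof (intro CollectI conjI allI impI; (elim conjE)?)
      show "?flip T \<in> extensional ?S" by simp
    next
      fix i j assume ij: "(i, j) \<in> ?S"
      show "lo i \<le> ?flip T (i, j)" "?flip T (i, j) \<le> hi i" "?flip T (i, j) \<le> int n"
        using ij TD(2)[OF ij] low_range[OF ij] by (auto simp: fl lo_def hi_def)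
    next
      fix i j l assume *: "(i, j) \<in> ?S" "(i, l) \<in> ?S" "j < l"
      show "?flip T (i, j) \<le> ?flip T (i, l)" if "i \<le> d"
        using * TD(3)[OF *(1,2) that *(3)] that by (simp add: fl)
      show "?flip T (i, j) < ?flip T (i, l)" if "d < i"
        using * TD(7)[OF *] lower[OF *(2) that] that by (simp add: fl)
    next
      fix i k j assume *: "(i, j) \<in> ?S" "(k, j) \<in> ?S" "i < k"
      show "?flip T (i, j) < ?flip T (k, j)" if "k \<le> d"
        using * TD(4)[OF * that] that by (simp add: fl)
      show "?flip T (i, j) \<le> ?flip T (k, j)" if "d < i"
        using * TD(6)[OF *(1,2) _ *(3)] lower[OF *(1) that] that by (simp add: fl)
    qed
    moreover have "?flip (?flip T) = T"
      using TD(1) ff by (auto simp: fun_eq_iff restrict_def extensional_def)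
    ultimately show ?thesis by blast
  qed
  have hook: "?flip U \<in> hook_tableaux \<nu> \<mu> \<and> ?flip (?flip U) = U"
    if U: "U \<in> position_tableaux (int n) (part \<nu>)" for U
  proof -
    note UD = position_tableauxD[OF U]
    have fl: "flip (U (i, j)) = (if i \<le> d then U (i, j) else int n + 1 - U (i, j))" if "(i, j) \<in> ?S" for i j
      using UD(2,3)[OF that] row[OF that] by (auto simp: flip_def lo_def hi_def split: if_splits)
    have ff: "flip (flip (U \<alpha>)) = U \<alpha>" if "\<alpha> \<in> ?S" for \<alpha>
      using UD(4)[of "fst \<alpha>" "snd \<alpha>"] that by (simp add: flip_def)
    have col: "int n + int j - int (conj_part \<mu> j) \<le> U (i, j)" if ij: "(i, j) \<in> ?S" "j \<le> d" for i j
    proof -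
      \<comment> \<open>The row of the topmost new box of column j. That box lies j - mu_k - 1 steps
        to the right of the first new box of row k, so mu_k cancels against the one in
        \<open>lo\<close>.\<close>
      let ?k = "conj_part \<mu> j + 1"
      have di: "d < i" using upper[OF ij(1)] ij(2) by (cases "i \<le> d") auto
      have j1: "1 \<le> j" using lower[OF ij(1) di] by simp
      have ki: "?k \<le> i"
        using conj_part_iff[OF mu row(1)[OF ij(1)] j1] ij(1) by (auto simp: in_boxes)
      have dk: "d < ?k" using conj_part_ge_d[OF j1 ij(2)] by simp
      have pk: "part \<mu> ?k < j" using conj_part_iff[OF mu _ j1, of ?k] by auto
      then have kj: "(?k, j) \<in> ?S"
        using ij(1) shapesD(4)[OF sh _ ki] by (auto simp: in_boxes)
      have "lo ?k + int (j - part \<mu> ?k - 1) \<le> U (?k, j)"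
        using position_tableaux_row_growth[OF U dk, of "j - part \<mu> ?k - 1"] pk kj by (simp add: in_boxes)
      moreover have "U (?k, j) \<le> U (i, j)"
        using UD(8)[OF kj ij(1) _ dk] ki by (cases "?k = i") auto
      ultimately show ?thesis using dk pk by (simp add: lo_def)
    qed
    have low: "d < i" if "(i, j) \<in> ?S" "j \<le> d" for i j
      using upper[OF that(1)] that(2) by (cases "i \<le> d") auto
    have "?flip U \<in> hook_tableaux \<nu> \<mu>"
      unfolding hook_tableaux_def Let_def skew_eq_boxes
    proof (intro CollectI conjI allI impI; (elim conjE)?)
      show "?flip U \<in> extensional ?S" by simp
      show "?flip U (i, j) \<in> {int i - int (part \<mu> i)..0}" if "(i, j) \<in> ?S" "i \<le> d" for i j
        using that UD(2,3)[OF that(1)] by (simp add: fl lo_def hi_def)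
      show "?flip U (i, j) \<le> ?flip U (i, l)" if "(i, j) \<in> ?S" "(i, l) \<in> ?S" "i \<le> d" "j < l" for i j l
        using that UD(5)[OF that(1,2,4,3)] by (simp add: fl)
      show "?flip U (i, j) < ?flip U (k, j)" if "(i, j) \<in> ?S" "(k, j) \<in> ?S" "i < k" "k \<le> d" for i k j
        using that UD(7)[OF that] by (simp add: fl)
      show "?flip U (i, j) \<in> {1..int (conj_part \<mu> j) - int j + 1}" if "(i, j) \<in> ?S" "j \<le> d" for i j
        using that UD(4)[OF that(1)] low[OF that] col[OF that] by (simp add: fl)
      show "?flip U (k, j) \<le> ?flip U (i, j)" if "(i, j) \<in> ?S" "(k, j) \<in> ?S" "j \<le> d" "i < k" for i k j
        using that UD(8)[OF that(1,2,4)] low[OF that(1,3)] by (simp add: fl)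
      show "?flip U (i, l) < ?flip U (i, j)" if "(i, j) \<in> ?S" "(i, l) \<in> ?S" "j < l" "l \<le> d" for i j l
        using that UD(6)[OF that(1,2,3)] low[OF that(2,4)] by (simp add: fl)
    qed
    moreover have "?flip (?flip U) = U"
      using UD(1) ff by (auto simp: fun_eq_iff restrict_def extensional_def)
    ultimately show ?thesis by blast
  qed
  show ?thesis
    unfolding tableau_sum_def skew_eq_boxes
  proof (rule sum.reindex_bij_witness[where i = ?flip and j = ?flip])
    fix U assume U: "U \<in> position_tableaux (int n) (part \<nu>)"
    show "?flip (?flip U) = U" "?flip U \<in> hook_tableaux \<nu> \<mu>" using hook[OF U] by auto
    have "flip (?flip U \<alpha>) = U \<alpha>" if "\<alpha> \<in> ?S" for \<alpha>
      using that fun_cong[OF hook[OF U, THEN conjunct2], of \<alpha>] by simp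
    then show "(\<Prod>\<alpha>\<in>?S. letter_weight (flip (?flip U \<alpha>))) = (\<Prod>\<alpha>\<in>?S. letter_weight (U \<alpha>))"
      by (intro prod.cong) auto
  next
    fix T assume "T \<in> hook_tableaux \<nu> \<mu>"
    from pos[OF this] show "?flip (?flip T) = T" "?flip T \<in> position_tableaux (int n) (part \<nu>)" by auto
  qed
qed

lemma tableau_sum_eq_hook_phi:
  assumes \<nu>: "\<nu> \<in> expansion_partitions B"
  shows "tableau_sum (int n) (part \<nu>) = (-1) ^ low_boxes \<nu> \<mu> * hook_phi \<nu> \<mu>"
proof -
  let ?S = "skew \<nu> \<mu>"
  let ?low = "{\<alpha> \<in> ?S. d < fst \<alpha>}"
  have fin: "finite ?S" unfolding skew_eq_boxes by (rule finite_boxes[OF part_in_shapes_if[OF \<nu>]])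
  have low: "low_boxes \<nu> \<mu> = card ?low"
    unfolding low_boxes_def by (rule arg_cong[where f = card]) auto
  have "(\<Prod>\<alpha>\<in>?S. letter_weight (flip (T \<alpha>))) = (-1) ^ low_boxes \<nu> \<mu> * (\<Prod>\<alpha>\<in>?S. avar (T \<alpha>))"
    if T: "T \<in> hook_tableaux \<nu> \<mu>" for T
  proof -
    have "letter_weight (flip (T \<alpha>)) = (if d < fst \<alpha> then - 1 else 1) * avar (T \<alpha>)" if \<alpha>: "\<alpha> \<in> ?S" for \<alpha>
    proof -
      obtain i j where ij: "\<alpha> = (i, j)" by (cases \<alpha>)
      show ?thesis
      proof (cases "i \<le> d")
        case True
        then have "T (i, j) \<le> 0" using T \<alpha> by (auto simp: hook_tableaux_def Let_def ij)
        then show ?thesis using True by (simp add: ij flip_def letter_weight_def)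
      next
        case False
        then have j: "1 \<le> j" "j \<le> d"
          using \<alpha> shapesD(5)[OF part_in_shapes_if[OF \<nu>], of i] by (auto simp: ij skew_eq_boxes in_boxes)
        then have T1: "1 \<le> T (i, j)" "T (i, j) \<le> int (conj_part \<mu> j) - int j + 1"
          using T \<alpha> by (auto simp: hook_tableaux_def Let_def ij)
        \<comment> \<open>Thus the letter is at most \<open>n\<close>, its position is positive, and
          the negative branch of \<open>letter_weight\<close> applies.\<close>
        have "conj_part \<mu> j \<le> n"
        proof (rule ccontr)
          assume "\<not> conj_part \<mu> j \<le> n"
          then have "j \<le> part \<mu> (Suc n)"
            using conj_part_iff[OF mu _ j(1), of "Suc n"] by simp
          then show False using j(1) part_eq_0[of \<mu> "Suc n"] len by simp
        qed
        with T1 j False show ?thesis by (simp add: ij flip_def letter_weight_def)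
      qed
    qed
    then have "(\<Prod>\<alpha>\<in>?S. letter_weight (flip (T \<alpha>)))
        = (\<Prod>\<alpha>\<in>?S. if d < fst \<alpha> then - 1 else 1) * (\<Prod>\<alpha>\<in>?S. avar (T \<alpha>))"
      by (simp add: prod.distrib)
    also have "(\<Prod>\<alpha>\<in>?S. if d < fst \<alpha> then - 1 else 1) = (- 1 :: Qa) ^ low_boxes \<nu> \<mu>"
      using fin by (simp add: low prod.If_cases Int_def)
    finally show ?thesis .
  qed
  then show ?thesis
    by (simp add: hook_tableaux_reindex[OF \<nu>] hook_phi_def sum_distrib_left)
qed

end

section \<open>The expansion of the dual Schur function\<close>

lemma part_1_le_sum_list: "part \<nu> 1 \<le> sum_list \<nu>"
  by (cases \<nu>) (auto simp: part_def)

text \<open>The terms are summed monomial by monomial into one series \<open>f\<close>, which is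
  then identified with the dual Schur function: \<open>f\<close> lies in \<open>Lambda_hat\<close>
  and has the right restrictions, and a series is determined by its restrictions.\<close>

theorem theorem3p17:
  fixes \<mu> :: "nat list" and d :: nat
  assumes "is_partition \<mu>"
    and "d = diag_len \<mu>"
  shows "has_formal_sum
           (\<lambda>\<nu>. mps_const ((-1) ^ low_boxes \<nu> \<mu> * hook_phi \<nu> \<mu>) * schur \<nu>)
           {\<nu>. is_partition \<nu> \<and> diagram \<mu> \<subseteq> diagram \<nu> \<and> diag_len \<nu> = d}
           (dual_schur \<mu>)"
proof -
  define c where "c \<nu> = (-1) ^ low_boxes \<nu> \<mu> * hook_phi \<nu> \<mu>" for \<nu>
  define K where "K = {\<nu>. is_partition \<nu> \<and> diagram \<mu> \<subseteq> diagram \<nu> \<and> diag_len \<nu> = d}"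
  define S where "S m = {\<nu> \<in> K. mps_coeff (mps_const (c \<nu>) * schur \<nu>) m \<noteq> 0}" for m
  define f where "f = Abs_mps (\<lambda>m. \<Sum>\<nu>\<in>S m. mps_coeff (mps_const (c \<nu>) * schur \<nu>) m)"
  have S_le: "sum_list \<nu> \<le> total_deg m" if "\<nu> \<in> S m" for \<nu> m
    using that order_ge_schur[of \<nu>] by (force simp: S_def K_def order_ge_def not_le[symmetric])
  have fin: "finite (S m)" for m
    by (rule finite_subset[OF _ finite_partitions_bounded[of "total_deg m"]])
       (use S_le in \<open>auto simp: S_def K_def\<close>)
  have sum: "has_formal_sum (\<lambda>\<nu>. mps_const (c \<nu>) * schur \<nu>) K f"
    using fin by (simp add: has_formal_sum_def f_def S_def)
  \<comment> \<open>Membership in \<open>Lambda_hat\<close> asks for coefficients on all partitions,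
    so \<open>c\<close> is extended by 0 outside \<open>K\<close>; the nonzero terms stay the
    same.\<close>
  have "{\<nu>. is_partition \<nu> \<and> mps_coeff (mps_const (if \<nu> \<in> K then c \<nu> else 0) * schur \<nu>) m \<noteq> 0} = S m" for m
    by (auto simp: S_def K_def)
  then have "has_formal_sum (\<lambda>\<nu>. mps_const (if \<nu> \<in> K then c \<nu> else 0) * schur \<nu>) {\<nu>. is_partition \<nu>} f"
    using fin by (auto simp: has_formal_sum_def f_def S_def intro!: sum.cong)
  then have Lambda: "f \<in> Lambda_hat"
    unfolding Lambda_hat_def mem_Collect_eq by (rule exI[where x = "\<lambda>\<nu>. if \<nu> \<in> K then c \<nu> else 0"])
  have restrict_f: "mps_coeff (mps_restrict n f) m = (\<Sum>\<nu>\<in>S m. c \<nu> * mps_coeff (schur_poly n \<nu>) m)"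
    if "Poly_Mapping.keys m \<subseteq> {..<n}" for n m
    using that by (auto simp: mps_coeff_restrict f_def S_def K_def mps_coeff_schur intro!: sum.cong)
  have "mps_restrict n f = dual_schur_fin n \<mu>" for n
  proof (cases "length \<mu> \<le> n")
    case False
    \<comment> \<open>Every diagram containing mu has more than \<open>n\<close> rows as well, so
      every term vanishes in \<open>n\<close> variables.\<close>
    have "mps_restrict n f = 0"
    proof (rule mps_eqI)
      fix m :: "nat \<Rightarrow>\<^sub>0 nat"
      have "schur_poly n \<nu> = 0" if "\<nu> \<in> S m" for \<nu>
        using that False length_le_if_diagram_subset[OF assms(1), of \<nu>]
        by (auto simp: S_def K_def schur_poly_def)
      then show "mps_coeff (mps_restrict n f) m = mps_coeff 0 m"
        using restrict_f[of m n] by (cases "Poly_Mapping.keys m \<subseteq> {..<n}") (auto simp: mps_coeff_restrict)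
    qed
    with False show ?thesis by (simp add: dual_schur_fin_def)
  next
    case True
    interpret dual_schur_setup \<mu> n by unfold_locales fact+
    have "mps_restrict n f * vandermonde n - ndet n (dual_schur_entry n \<mu>) = 0"
    proof (rule mps_eq_0I)
      fix k
      \<comment> \<open>B >= k gives the wanted order, and B >= mu_1 puts mu itself among the
        shapes.\<close>
      define B where "B = max k (part \<mu> 1)"
      define E where "E = expansion_partitions B"
      have finE: "finite E"
        using bij_betw_finite[OF bij_betw_part[of B]] by (simp add: E_def)
      let ?P = "\<Sum>\<nu>\<in>E. mps_const (c \<nu>) * schur_poly n \<nu>"
      have "order_ge B (mps_restrict n f - ?P)"
        unfolding order_ge_def
      proof (intro allI impI)
        fix m :: "nat \<Rightarrow>\<^sub>0 nat" assume m: "total_deg m < B"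
        show "mps_coeff (mps_restrict n f - ?P) m = 0"
        proof (cases "Poly_Mapping.keys m \<subseteq> {..<n}")
          case keys: True
          have "(\<Sum>\<nu>\<in>S m. c \<nu> * mps_coeff (schur_poly n \<nu>) m) = (\<Sum>\<nu>\<in>S m \<inter> E. c \<nu> * mps_coeff (schur_poly n \<nu>) m)"
          proof (rule sum.mono_neutral_right[OF fin], simp, rule ballI)
            fix \<nu> assume \<nu>: "\<nu> \<in> S m - S m \<inter> E"
            \<comment> \<open>The size of \<nu> is at most the degree of \<open>m\<close>, hence
              below \<open>B\<close>; so \<nu> can miss \<open>E\<close> only by having more than
              \<open>n\<close> parts.\<close>
            then have "part \<nu> 1 \<le> B"
              using S_le[of \<nu> m] part_1_le_sum_list[of \<nu>] m by auto
            with \<nu> have "n < length \<nu>"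
              by (auto simp: S_def K_def E_def expansion_partitions_def assms(2))
            then show "c \<nu> * mps_coeff (schur_poly n \<nu>) m = 0" by (simp add: schur_poly_def)
          qed
          also have "\<dots> = (\<Sum>\<nu>\<in>E. c \<nu> * mps_coeff (schur_poly n \<nu>) m)"
            using mps_coeff_schur[OF _ keys]
            by (intro sum.mono_neutral_left finE) (auto simp: S_def K_def E_def expansion_partitions_def assms(2))
          finally show ?thesis by (simp add: restrict_f[OF keys] mps_coeff_sum)
        next
          case False
          then have "mps_coeff (schur_poly n \<nu>) m = 0" for \<nu>
            by (subst mps_restrict_schur_poly_self[symmetric]) (simp add: mps_coeff_restrict)
          with False show ?thesis by (simp add: mps_coeff_restrict mps_coeff_sum)
        qed
      qed
      then have "order_ge B ((mps_restrict n f - ?P) * vandermonde n)"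
        by (rule order_ge_mult_right)
      moreover have "?P * vandermonde n
          = (\<Sum>\<nu>\<in>E. mps_const (tableau_sum (int n) (part \<nu>)) * ndet n (\<lambda>i j. xvar i ^ (part \<nu> j + n - j)))"
        unfolding sum_distrib_right
        by (intro sum.cong refl)
           (auto simp: E_def tableau_sum_eq_hook_phi c_def mult.assoc schur_poly_alternant expansion_partitions_def)
      moreover have "\<dots> = (\<Sum>\<rho>\<in>shapes B. mps_const (tableau_sum (int n) \<rho>) * ndet n (\<lambda>i j. xvar i ^ (\<rho> j + n - j)))"
        unfolding E_def by (rule sum.reindex_bij_betw[OF bij_betw_part])
      moreover have "order_ge B (ndet n (dual_schur_entry n \<mu>)
          - (\<Sum>\<rho>\<in>shapes B. mps_const (tableau_sum (int n) \<rho>) * ndet n (\<lambda>i j. xvar i ^ (\<rho> j + n - j))))"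
        by (rule dual_schur_det_expansion) (simp add: B_def)
      ultimately have "order_ge B (mps_restrict n f * vandermonde n - ndet n (dual_schur_entry n \<mu>))"
        using order_ge_diff by (fastforce simp: left_diff_distrib)
      then show "order_ge k (mps_restrict n f * vandermonde n - ndet n (dual_schur_entry n \<mu>))"
        by (rule order_ge_mono) (simp add: B_def)
    qed
    then have "mps_quot (ndet n (dual_schur_entry n \<mu>)) (vandermonde n) = mps_restrict n f"
      by (intro mps_quot_vandermonde) simp
    with True show ?thesis by (simp add: dual_schur_fin_def ndet_def)
  qed
  then have "dual_schur \<mu> = f"
    unfolding dual_schur_def using Lambda by (intro the_equality) (auto intro: mps_eq_restrictI)
  with sum show ?thesis by (simp add: c_def K_def)
qed

end
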